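(* For any Lagrangian planes $\mathcal{L}_1,\mathcal{L}_2,\mathcal{L}_3$ in $\mathbb{C}^n\oplus\mathbb{C}^n$, $$s(\mathcal{L}_1,\mathcal{L}_2,\mathcal{L}_3)=\iota(\mathcal{L}_2,\mathcal{L}_1,\mathcal{L}_3)-\iota(\mathcal{L}_3,\mathcal{L}_1,\mathcal{L}_2)$$ or, equivalently, $$\iota(\mathcal{L}_1,\mathcal{L}_2,\mathcal{L}_3)=\tfrac12\Big(n-\dim(\mathcal{L}_1\cap\mathcal{L}_2)+\dim(\mathcal{L}_1\cap\mathcal{L}_3)-\dim(\mathcal{L}_2\cap\mathcal{L}_3)-s(\mathcal{L}_1,\mathcal{L}_2,\mathcal{L}_3)\Big).$$
   Context: $\mathbb{C}^n\oplus\mathbb{C}^n$ is equipped with the canonical (sesquilinear) Hermitian symplectic form $\omega((x_1,x_2),(y_1,y_2)) := \langle x_1,y_2\rangle_{\mathbb{C}^n} - \langle x_2,y_1\rangle_{\mathbb{C}^n}$. A subspace $\mathcal{L}$ is Lagrangian if it equals $\{v : \omega(u,v)=0 \text{ for all } u\in\mathcal{L}\}$; $\Lambda(n)$ is the set of Lagrangian planes. For an $n\times n$ Hermitian matrix $M$, $\mathcal{G}_M := \{(x,Mx): x\in\mathbb{C}^n\}$, and $\mathcal{G}_\infty := 0\oplus\mathbb{C}^n$. $n_\pm$ is the number of positive/negative eigenvalues counted with multiplicity. For Lagrangian planes $\mathcal{L}_1,\mathcal{L}_2,\mathcal{L}_3$ let $\Omega$ be the Hermitian form on $\mathcal{L}_1\oplus\mathcal{L}_2\oplus\mathcal{L}_3$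 given by $\Omega(u_1,u_2,u_3;v_1,v_2,v_3)=\omega(u_1,v_2)+\omega(u_2,v_3)+\omega(u_3,v_1)-\omega(u_2,v_1)-\omega(u_3,v_2)-\omega(u_1,v_3)$. The Hörmander–Kashiwara–Wall index is the signature $s(\mathcal{L}_1,\mathcal{L}_2,\mathcal{L}_3):=n_+(\Omega)-n_-(\Omega)$. The Duistermaat index $\iota:\Lambda(n)^3\to\{0,\dots,n\}$ is the unique function such that (1) $\iota(\mathcal{G}_0,\mathcal{G}_A,\mathcal{G}_\infty)=n_-(A)$ for every Hermitian $A$; (2) $\iota$ is invariant under applying a linear symplectic transformation to all three arguments; (3) $\iota(\mathcal{L}_1,\mathcal{L}_2,\mathcal{L}_3)-\iota(\mathcal{L}_1,\mathcal{L}_2,\mathcal{L}_4)+\iota(\mathcal{L}_1,\mathcal{L}_3,\mathcal{L}_4)-\iota(\mathcal{L}_2,\mathcal{L}_3,\mathcal{L}_4)=0$ for all Lagrangian planes. Explicitly, $\iota(\mathcal{L}_1,\mathcal{L}_2,\mathcal{L}_3)=n_-(\Omega)-n+\dim(\mathcal{L}_1\cap\mathcal{L}_3)$. *)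

theory Defs
  imports "HOL-Analysis.Analysis"
begin

type_synonym 'n sympl = "(complex^'n) \<times> (complex^'n)"

type_synonym 'n triple = "'n sympl \<times> 'n sympl \<times> 'n sympl"

text \<open>Complex scalar multiplication on \<open>\<complex>\<^sup>n \<oplus> \<complex>\<^sup>n\<close> and on threefold products of it. The library's
  overloaded \<open>subspace\<close>, \<open>dim\<close> and \<open>linear\<close> on these types are over the reals, so the complex
  versions are obtained by interpreting the vector space locales.\<close>

definition scale2 :: "complex \<Rightarrow> 'n::finite sympl \<Rightarrow> 'n sympl"
  where "scale2 c u = (c *s fst u, c *s snd u)"

definition scale6 :: "complex \<Rightarrow> 'n::finite triple \<Rightarrow> 'n triple"
  where "scale6 c u = (scale2 c (fst u), scale2 c (fst (snd u)), scale2 c (snd (snd u)))"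

definition basis2 :: "'n::finite sympl set"
  where "basis2 = cart_basis \<times> {0} \<union> {0} \<times> cart_basis"

definition basis6 :: "'n::finite triple set"
  where "basis6 = basis2 \<times> {0} \<union> {0} \<times> (basis2 \<times> {0} \<union> {0} \<times> basis2)"

interpretation sp2: finite_dimensional_vector_space
  "scale2 :: complex \<Rightarrow> 'n::finite sympl \<Rightarrow> 'n sympl" "basis2 :: 'n sympl set"
proof -
  interpret P: finite_dimensional_vector_space_prod
    "(*s) :: complex \<Rightarrow> complex^'n \<Rightarrow> complex^'n" "(*s) :: complex \<Rightarrow> complex^'n \<Rightarrow> complex^'n"
    cart_basis cart_basis ..
  have "P.scale = scale2"
    by (auto simp: fun_eq_iff P.scale_def scale2_def)
  moreover have "P.Basis_pair = basis2"
    by (simp add: P.Basis_pair_def basis2_def)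
  ultimately show "finite_dimensional_vector_space (scale2 :: complex \<Rightarrow> 'n sympl \<Rightarrow> 'n sympl) basis2"
    using P.p.finite_dimensional_vector_space_axioms by simp
qed

interpretation sp6: finite_dimensional_vector_space
  "scale6 :: complex \<Rightarrow> 'n::finite triple \<Rightarrow> 'n triple" "basis6 :: 'n triple set"
proof -
  interpret P: finite_dimensional_vector_space_prod
    "scale2 :: complex \<Rightarrow> 'n sympl \<Rightarrow> 'n sympl" "scale2 :: complex \<Rightarrow> 'n sympl \<Rightarrow> 'n sympl"
    basis2 basis2 ..
  interpret Q: finite_dimensional_vector_space_prod
    "scale2 :: complex \<Rightarrow> 'n sympl \<Rightarrow> 'n sympl" "P.scale"
    basis2 P.Basis_pair ..
  have "Q.scale = scale6"
    by (auto simp: fun_eq_iff P.scale_def Q.scale_def scale6_def)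
  moreover have "Q.Basis_pair = basis6"
    by (subst Q.Basis_pair_def) (simp add: P.Basis_pair_def basis6_def)
  ultimately show "finite_dimensional_vector_space (scale6 :: complex \<Rightarrow> 'n triple \<Rightarrow> 'n triple) basis6"
    using Q.p.finite_dimensional_vector_space_axioms by simp
qed

text \<open>Linear in the first argument; the opposite convention conjugates \<open>omega\<close> and \<open>Omega\<close> below
  and changes none of the indices.\<close>

definition cinner :: "complex^'n::finite \<Rightarrow> complex^'n \<Rightarrow> complex"
  where "cinner x y = (\<Sum>i\<in>UNIV. x $ i * cnj (y $ i))"

definition cinner2 :: "'n::finite sympl \<Rightarrow> 'n sympl \<Rightarrow> complex"
  where "cinner2 u v = cinner (fst u) (fst v) + cinner (snd u) (snd v)"

fun cinner6 :: "'n::finite triple \<Rightarrow> 'n triple \<Rightarrow> complex"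
  where "cinner6 (u1, u2, u3) (v1, v2, v3) = cinner2 u1 v1 + cinner2 u2 v2 + cinner2 u3 v3"

definition omega :: "'n::finite sympl \<Rightarrow> 'n sympl \<Rightarrow> complex"
  where "omega u v = cinner (fst u) (snd v) - cinner (snd u) (fst v)"

definition lagrangian :: "'n::finite sympl set \<Rightarrow> bool"
  where "lagrangian L \<longleftrightarrow> sp2.subspace L \<and> L = {v. \<forall>u\<in>L. omega u v = 0}"

definition Lambda :: "'n::finite sympl set set"
  where "Lambda = {L. lagrangian L}"

definition hermitian :: "complex^'n^'n::finite \<Rightarrow> bool"
  where "hermitian M \<longleftrightarrow> (\<forall>i j. M $ i $ j = cnj (M $ j $ i))"

definition graph :: "complex^'n^'n::finite \<Rightarrow> 'n sympl set"
  where "graph M = {(x, M *v x) | x. True}"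

definition graph_inf :: "'n::finite sympl set"
  where "graph_inf = {0} \<times> UNIV"

text \<open>The multiplicity of an eigenvalue is the complex dimension of its eigenspace, which for
  Hermitian matrices and forms is also its algebraic multiplicity.\<close>

definition mat_eigenspace :: "complex^'n^'n::finite \<Rightarrow> real \<Rightarrow> (complex^'n) set"
  where "mat_eigenspace A l = {x. A *v x = complex_of_real l *s x}"

definition mat_n_minus :: "complex^'n^'n::finite \<Rightarrow> nat"
  where "mat_n_minus A =
    (\<Sum>l | l < 0 \<and> mat_eigenspace A l \<noteq> {0}. vec.dim (mat_eigenspace A l))"

text \<open>The eigenvalues of a Hermitian form \<open>h\<close> on a subspace \<open>V\<close> are those of the self-adjoint
  operator on \<open>V\<close> that represents \<open>h\<close> with respect to the standard inner product. By Sylvester's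
  law, their numbers by sign do not depend on the inner product.\<close>

definition form_eigenspace ::
    "'n::finite triple set \<Rightarrow> ('n triple \<Rightarrow> 'n triple \<Rightarrow> complex) \<Rightarrow> real \<Rightarrow> 'n triple set"
  where "form_eigenspace V h l = {u\<in>V. \<forall>v\<in>V. h u v = complex_of_real l * cinner6 u v}"

definition form_n_plus ::
    "'n::finite triple set \<Rightarrow> ('n triple \<Rightarrow> 'n triple \<Rightarrow> complex) \<Rightarrow> nat"
  where "form_n_plus V h =
    (\<Sum>l | l > 0 \<and> form_eigenspace V h l \<noteq> {0}. sp6.dim (form_eigenspace V h l))"

definition form_n_minus ::
    "'n::finite triple set \<Rightarrow> ('n triple \<Rightarrow> 'n triple \<Rightarrow> complex) \<Rightarrow> nat"
  where "form_n_minus V h =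
    (\<Sum>l | l < 0 \<and> form_eigenspace V h l \<noteq> {0}. sp6.dim (form_eigenspace V h l))"

fun Omega :: "'n::finite triple \<Rightarrow> 'n triple \<Rightarrow> complex"
  where "Omega (u1, u2, u3) (v1, v2, v3) =
    omega u1 v2 + omega u2 v3 + omega u3 v1 - omega u2 v1 - omega u3 v2 - omega u1 v3"

definition hkw_index :: "'n::finite sympl set \<Rightarrow> 'n sympl set \<Rightarrow> 'n sympl set \<Rightarrow> int"
  where "hkw_index L1 L2 L3 =
    int (form_n_plus (L1 \<times> L2 \<times> L3) Omega) - int (form_n_minus (L1 \<times> L2 \<times> L3) Omega)"

text \<open>Preservation of the nondegenerate form \<open>omega\<close> makes such a map invertible.\<close>

definition symplectic_map :: "('n::finite sympl \<Rightarrow> 'n sympl) \<Rightarrow> bool"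
  where "symplectic_map T \<longleftrightarrow>
    Vector_Spaces.linear scale2 scale2 T \<and> (\<forall>u v. omega (T u) (T v) = omega u v)"

text \<open>The extensional function space makes \<open>j\<close> a function on triples of Lagrangian planes only, so
  that the axioms can determine it uniquely.\<close>

definition is_duistermaat_index ::
    "('n::finite sympl set \<times> 'n sympl set \<times> 'n sympl set \<Rightarrow> int) \<Rightarrow> bool"
  where "is_duistermaat_index j \<longleftrightarrow>
    j \<in> (Lambda \<times> Lambda \<times> Lambda) \<rightarrow>\<^sub>E {0..int CARD('n)} \<and>
    (\<forall>A. hermitian A \<longrightarrow> j (graph 0, graph A, graph_inf) = int (mat_n_minus A)) \<and>
    (\<forall>T. symplectic_map T \<longrightarrow> (\<forall>L1\<in>Lambda. \<forall>L2\<in>Lambda. \<forall>L3\<in>Lambda.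
       j (T ` L1, T ` L2, T ` L3) = j (L1, L2, L3))) \<and>
    (\<forall>L1\<in>Lambda. \<forall>L2\<in>Lambda. \<forall>L3\<in>Lambda. \<forall>L4\<in>Lambda.
       j (L1, L2, L3) - j (L1, L2, L4) + j (L1, L3, L4) - j (L2, L3, L4) = 0)"

definition duistermaat_index :: "'n::finite sympl set \<Rightarrow> 'n sympl set \<Rightarrow> 'n sympl set \<Rightarrow> int"
  where "duistermaat_index L1 L2 L3 = (THE j. is_duistermaat_index j) (L1, L2, L3)"

end

theory Submission
  imports Defs
begin

text \<open>
  For any finite family of Lagrangian planes \<open>L\<close> some real \<open>t\<close> makes \<open>{(x, t x)}\<close> transversal to all of
  them, so a symplectic map turns the whole family into graphs of Hermitian matrices \<open>A\<^sub>i\<close>. On three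
  graphs, parametrised by \<open>x\<^sub>1 = b + c\<close>, \<open>x\<^sub>2 = a + c\<close>, \<open>x\<^sub>3 = a + b\<close>, the form \<open>\<Omega>\<close> is block diagonal with
  blocks \<open>2 (A\<^sub>3 - A\<^sub>2)\<close>, \<open>2 (A\<^sub>1 - A\<^sub>3)\<close>, \<open>2 (A\<^sub>2 - A\<^sub>1)\<close>. Writing \<open>m\<^sub>i\<^sub>j = n\<^sub>- (A\<^sub>j - A\<^sub>i)\<close>, the index
  \<open>n\<^sub>- (\<Omega>) - n + dim (L\<^sub>1 \<inter> L\<^sub>3)\<close> becomes \<open>m\<^sub>1\<^sub>2 + m\<^sub>2\<^sub>3 - m\<^sub>1\<^sub>3\<close>, which visibly satisfies the cocycle identity.
  Conversely the axioms force this value: insert \<open>graph_inf\<close> as fourth plane in the cocycle identity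
  and shear \<open>graph A\<^sub>i\<close> to \<open>graph 0\<close>. Both claims are then linear consequences of
  \<open>m\<^sub>i\<^sub>j + m\<^sub>j\<^sub>i + dim (L\<^sub>i \<inter> L\<^sub>j) = n\<close>.
\<close>

section \<open>Inertia of Hermitian forms\<close>

text \<open>The same inertia theory serves \<open>complex^'n\<close> and the threefold sums. The
  assumption on \<open>Re (ip u v)\<close> ties the complex structure to the real Euclidean one,
  which gives access to norms and to compactness of the unit sphere.\<close>

locale hermitian_space = finite_dimensional_vector_space scale basis
  for scale :: "complex \<Rightarrow> 'a::euclidean_space \<Rightarrow> 'a" and basis :: "'a set" +
  fixes ip :: "'a \<Rightarrow> 'a \<Rightarrow> complex"
  assumes ip_add_left: "ip (u + v) w = ip u w + ip v w"
    and ip_scale_left: "ip (scale c u) w = c * ip u w"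
    and ip_cnj: "ip v u = cnj (ip u v)"
    and Re_ip: "Re (ip u v) = u \<bullet> v"
begin

definition herm_form :: "('a \<Rightarrow> 'a \<Rightarrow> complex) \<Rightarrow> bool"
  where "herm_form h \<longleftrightarrow> (\<forall>u v w. h (u + v) w = h u w + h v w) \<and>
    (\<forall>c u w. h (scale c u) w = c * h u w) \<and> (\<forall>u v. h v u = cnj (h u v))"

lemma herm_formI:
  assumes "\<And>u v w. h (u + v) w = h u w + h v w" "\<And>c u w. h (scale c u) w = c * h u w"
    "\<And>u v. h v u = cnj (h u v)"
  shows "herm_form h"
  using assms unfolding herm_form_def by blast

lemma herm_form_ip: "herm_form ip"
  by (metis herm_form_def ip_add_left ip_scale_left ip_cnj)

text \<open>Both sides have the same real inner product with every vector. This lets complex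
  subspaces be viewed as real ones.\<close>

lemma scale_of_real: "scale (of_real r) u = r *\<^sub>R u"
  by (rule vector_eq_rdot[THEN iffD1]) (simp flip: Re_ip add: ip_scale_left, simp add: Re_ip)

lemma ip_self: "ip u u = of_real ((norm u)\<^sup>2)"
proof -
  have "Im (ip u u) = 0" using ip_cnj[of u u] by (metis Reals_cnj_iff complex_is_Real_iff)
  then show ?thesis by (simp add: complex_eq_iff Re_ip power2_norm_eq_inner)
qed

section \<open>Hermitian forms and existence of eigenvectors\<close>

context
  fixes h assumes h: "herm_form h"
begin

lemma herm_add_left: "h (u + v) w = h u w + h v w"
  and herm_scale_left: "h (scale c u) w = c * h u w"
  and herm_cnj: "h v u = cnj (h u v)"
  using h unfolding herm_form_def by blast+

lemma herm_add_right: "h w (u + v) = h w u + h w v"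
  by (metis herm_add_left herm_cnj complex_cnj_add)

lemma herm_scale_right: "h w (scale c u) = cnj c * h w u"
  by (metis herm_scale_left herm_cnj complex_cnj_mult)

lemma herm_zero_left: "h 0 w = 0"
  using herm_scale_left[of 0 0 w] by simp

lemma herm_zero_right: "h w 0 = 0"
  using herm_scale_right[of w 0 0] by simp

lemma herm_real: "h u u = of_real (Re (h u u))"
  using herm_cnj[of u u] by (metis Reals_cnj_iff of_real_Re)

lemma herm_sum_left: "h (\<Sum>b\<in>B. f b) w = (\<Sum>b\<in>B. h (f b) w)"
  by (induction B rule: infinite_finite_induct) (auto simp: herm_add_left herm_zero_left)

lemma herm_sum_right: "h w (\<Sum>b\<in>B. f b) = (\<Sum>b\<in>B. h w (f b))"
  by (induction B rule: infinite_finite_induct) (auto simp: herm_add_right herm_zero_right)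

lemma herm_uminus: "herm_form (\<lambda>u v. - h u v)"
  by (rule herm_formI) (simp_all add: herm_add_left herm_scale_left flip: herm_cnj)

lemma continuous_on_herm: "continuous_on S (\<lambda>u. Re (h u u))"
proof -
  have "bilinear h"
    unfolding bilinear_def
    by (auto intro!: linearI simp: herm_add_left herm_add_right herm_scale_left herm_scale_right
        simp flip: scale_of_real) (auto simp: scaleR_conv_of_real)
  then have "bounded_bilinear h" by (simp add: bilinear_conv_bounded_bilinear)
  then show ?thesis
    using bounded_bilinear.continuous_on[OF _ continuous_on_id continuous_on_id, of h S]
    by (intro continuous_on_Re) simp
qed

text \<open>The degenerate case of Cauchy-Schwarz: if \<open>h u v\<close> were nonzero, adding
  multiples of the null vector \<open>u\<close> to \<open>v\<close> would change the value of
  \<open>h\<close> linearly and push it below zero.\<close>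

lemma herm_psd_kernel:
  assumes V: "subspace V" and psd: "\<And>w. w \<in> V \<Longrightarrow> Re (h w w) \<ge> 0"
    and u: "u \<in> V" "h u u = 0" and v: "v \<in> V"
  shows "h u v = 0"
proof (rule ccontr)
  assume nz: "h u v \<noteq> 0"
  \<comment> \<open>The factor \<open>cnj (h u v)\<close> in \<open>c\<close> makes the cross term
    real, and \<open>r\<close> is chosen so that the value at \<open>scale c u + v\<close> is
    exactly -1.\<close>
  define r where "r = (Re (h v v) + 1) / (2 * (cmod (h u v))\<^sup>2)"
  define c where "c = - of_real r * cnj (h u v)"
  have "h (scale c u + v) (scale c u + v) = c * h u v + cnj (c * h u v) + h v v"
    using u(2) herm_cnj[of v u]
    by (simp add: herm_add_left herm_add_right herm_scale_left herm_scale_right)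
  moreover have "c * h u v = of_real (- r * (cmod (h u v))\<^sup>2)"
    using complex_norm_square[of "h u v"] by (simp add: c_def mult.commute)
  ultimately have "Re (h (scale c u + v) (scale c u + v)) = - 2 * (r * (cmod (h u v))\<^sup>2) + Re (h v v)"
    by simp
  also have "\<dots> = -1" using nz by (simp add: r_def field_simps)
  finally show False
    using psd[of "scale c u + v"] V u v by (simp add: subspace_add subspace_scale)
qed

text \<open>Rayleigh's principle: \<open>u\<close> maximises \<open>h\<close> on the compact unit
  sphere of \<open>V\<close>, and the maximum is the eigenvalue.\<close>

lemma eigenvector_exists:
  assumes V: "subspace V" and ne: "V \<noteq> {0}"
  obtains u where "u \<in> V" "ip u u = 1" "\<And>v. v \<in> V \<Longrightarrow> h u v = of_real (Re (h u u)) * ip u v"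
proof -
  have "real_vector.subspace V"
    unfolding real_vector.subspace_def using V
    by (auto simp: subspace_0 subspace_add subspace_scale simp flip: scale_of_real)
  then have "compact (sphere 0 1 \<inter> V)"
    by (intro compact_Int_closed closed_subspace) auto
  moreover have nrm: "(1 / norm w) *\<^sub>R w \<in> sphere 0 1 \<inter> V" if "w \<in> V" "w \<noteq> 0" for w
    using that subspace_scale[OF V, of w "of_real (1 / norm w)"] unfolding scale_of_real by simp
  obtain w0 where "w0 \<in> V" "w0 \<noteq> 0" using ne V subspace_0 by blast
  then have "sphere 0 1 \<inter> V \<noteq> {}" using nrm by blast
  ultimately obtain u where u: "u \<in> sphere 0 1 \<inter> V"
    and mx: "\<And>w. w \<in> sphere 0 1 \<inter> V \<Longrightarrow> Re (h w w) \<le> Re (h u u)"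
    using continuous_attains_sup[OF _ _ continuous_on_herm] by metis
  define l where "l = Re (h u u)"
  \<comment> \<open>By maximality of \<open>l\<close> this form is nonnegative on \<open>V\<close>,
    and it vanishes at \<open>u\<close>. That \<open>u\<close> lies in its kernel on
    \<open>V\<close> is the eigenvector equation.\<close>
  define g where "g = (\<lambda>w v. of_real l * ip w v - h w v)"
  have g: "herm_form g"
    unfolding g_def
    by (rule herm_formI)
      (simp_all add: herm_add_left herm_scale_left ip_add_left ip_scale_left algebra_simps
        flip: herm_cnj ip_cnj)
  have hs: "h w w = of_real ((norm w)\<^sup>2) * h ((1 / norm w) *\<^sub>R w) ((1 / norm w) *\<^sub>R w)"
    if "w \<noteq> 0" for w
  proof -
    have "w = scale (of_real (norm w)) ((1 / norm w) *\<^sub>R w)"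
      using that by (simp add: scale_of_real)
    then have "h w w = of_real (norm w) * (cnj (of_real (norm w)) * h ((1 / norm w) *\<^sub>R w) ((1 / norm w) *\<^sub>R w))"
      by (metis herm_scale_left herm_scale_right)
    then show ?thesis by (simp only: complex_cnj_complex_of_real power2_eq_square of_real_mult mult.assoc)
  qed
  have psd: "Re (g w w) \<ge> 0" if "w \<in> V" for w
  proof (cases "w = 0")
    case True then show ?thesis by (simp add: g_def herm_zero_left ip_self)
  next
    case False
    have "Re (h w w) = (norm w)\<^sup>2 * Re (h ((1 / norm w) *\<^sub>R w) ((1 / norm w) *\<^sub>R w))"
      by (subst hs[OF False]) (simp del: of_real_power)
    also have "\<dots> \<le> (norm w)\<^sup>2 * l"
      unfolding l_def by (intro mult_left_mono mx nrm that False) auto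
    finally show ?thesis by (simp add: g_def ip_self mult.commute flip: of_real_power)
  qed
  have ipu: "ip u u = 1" using u by (simp add: ip_self)
  have "g u u = 0" unfolding g_def l_def ipu using herm_real[of u] by simp
  have "h u v = of_real (Re (h u u)) * ip u v" if "v \<in> V" for v
    using hermitian_space.herm_psd_kernel[OF hermitian_space_axioms g V psd _ \<open>g u u = 0\<close> that] u
    by (simp add: g_def l_def)
  then show thesis using that u ipu by blast
qed

end

text \<open>The eigenvalue of \<open>b\<close> is recorded as \<open>Re (h b b)\<close>, which is
  consistent because \<open>ip b b = 1\<close>. The eigenvector equation is tested on
  \<open>V\<close> only, so it concerns the compression of \<open>h\<close> to
  \<open>V\<close>.\<close>

definition eigenbasis :: "'a set \<Rightarrow> ('a \<Rightarrow> 'a \<Rightarrow> complex) \<Rightarrow> 'a set \<Rightarrow> bool"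
  where "eigenbasis V h B \<longleftrightarrow> finite B \<and> B \<subseteq> V \<and> V \<subseteq> span B \<and>
    (\<forall>b\<in>B. \<forall>c\<in>B. ip b c = (if b = c then 1 else 0)) \<and>
    (\<forall>b\<in>B. \<forall>v\<in>V. h b v = of_real (Re (h b b)) * ip b v)"

lemma orthonormal_coeff:
  assumes "finite B" "\<And>b c. b \<in> B \<Longrightarrow> c \<in> B \<Longrightarrow> ip b c = (if b = c then 1 else 0)" "c \<in> B"
  shows "ip (\<Sum>b\<in>B. scale (f b) b) c = f c"
proof -
  have "ip (\<Sum>b\<in>B. scale (f b) b) c = (\<Sum>b\<in>B. f b * ip b c)"
    by (simp add: herm_sum_left[OF herm_form_ip] ip_scale_left)
  also have "\<dots> = (\<Sum>b\<in>B. if b = c then f b else 0)"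
    using assms(2,3) by (intro sum.cong) (auto split: if_splits)
  finally have "ip (\<Sum>b\<in>B. scale (f b) b) c = (\<Sum>b\<in>B. if b = c then f b else 0)" .
  then show ?thesis using assms by simp
qed

lemma orthonormal_independent:
  assumes "finite B" "\<And>b c. b \<in> B \<Longrightarrow> c \<in> B \<Longrightarrow> ip b c = (if b = c then 1 else 0)"
  shows "independent B"
  using assms(1)
proof (rule independent_if_scalars_zero)
  fix f x assume "(\<Sum>b\<in>B. scale (f b) b) = 0" "x \<in> B"
  then show "f x = 0"
    using orthonormal_coeff[OF assms] herm_zero_left[OF herm_form_ip] by metis
qed

lemma orthonormal_expansion:
  assumes "finite B" "\<And>b c. b \<in> B \<Longrightarrow> c \<in> B \<Longrightarrow> ip b c = (if b = c then 1 else 0)" "v \<in> span B"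
  shows "v = (\<Sum>b\<in>B. scale (ip v b) b)"
proof -
  obtain f where f: "v = (\<Sum>b\<in>B. scale (f b) b)"
    using assms(1,3) span_finite by auto
  then have "ip v b = f b" if "b \<in> B" for b
    using orthonormal_coeff[OF assms(1,2) that] by simp
  then show ?thesis using f by simp
qed

text \<open>The spectral theorem, by induction on the dimension: split off a unit eigenvector
  \<open>u\<close> and continue in its orthogonal complement \<open>W\<close> within
  \<open>V\<close>.\<close>

lemma eigenbasis_exists:
  assumes h: "herm_form h" and V: "subspace V"
  shows "\<exists>B. eigenbasis V h B"
  using V
proof (induction "dim V" arbitrary: V rule: less_induct)
  case less
  show ?case
  proof (cases "V = {0}")
    case True
    then have "eigenbasis V h {}" by (simp add: eigenbasis_def)
    then show ?thesis ..
  next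
    case False
    obtain u where u: "u \<in> V" "ip u u = 1"
      and eig: "\<And>v. v \<in> V \<Longrightarrow> h u v = of_real (Re (h u u)) * ip u v"
      by (rule eigenvector_exists[OF h less.prems False]) blast
    define W where "W = {v \<in> V. ip v u = 0}"
    have W: "subspace W"
      using less.prems herm_zero_left[OF herm_form_ip] unfolding W_def subspace_def
      by (auto simp: ip_add_left ip_scale_left)
    have "dim W < dim V"
    proof -
      have "W \<subset> V" using u unfolding W_def by force
      then have "span W \<subset> span V" using W less.prems by (simp add: span_eq_iff[THEN iffD2])
      then show ?thesis by (rule dim_psubset)
    qed
    then obtain B where B: "eigenbasis W h B" using less.hyps W by blast
    have orth: "ip u b = 0" "ip b u = 0" if "b \<in> B" for b
      using B that ip_cnj[of u b] by (auto simp: eigenbasis_def W_def)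
    have spl: "scale (ip v u) u + (v - scale (ip v u) u) = v" "v - scale (ip v u) u \<in> W" if "v \<in> V" for v
    proof -
      have "v - scale (ip v u) u = v + scale (- ip v u) u" by (simp add: scale_minus_left)
      then have "ip (v - scale (ip v u) u) u = 0"
        using u by (simp only: ip_add_left ip_scale_left) simp
      then show "v - scale (ip v u) u \<in> W"
        using that u less.prems by (simp add: W_def subspace_diff subspace_scale)
    qed simp
    have sub: "v \<in> span (insert u B)" if "v \<in> V" for v
    proof -
      have "v - scale (ip v u) u \<in> span (insert u B)"
        using spl(2)[OF that] B span_mono[of B "insert u B"] by (auto simp: eigenbasis_def)
      moreover have "scale (ip v u) u \<in> span (insert u B)"
        by (intro span_scale span_base) auto
      ultimately show ?thesis using span_add spl(1)[OF that] by metis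
    qed
    \<comment> \<open>The induction hypothesis gives this equation on \<open>W\<close> only. It
      extends to \<open>V\<close> because both \<open>ip b u\<close> and \<open>h b u\<close>
      vanish, the latter since \<open>u\<close> is an eigenvector orthogonal to
      \<open>b\<close>.\<close>
    have "h b v = of_real (Re (h b b)) * ip b v" if b: "b \<in> B" and v: "v \<in> V" for b v
    proof -
      define w where "w = v - scale (ip v u) u"
      have "b \<in> V" using B b by (auto simp: eigenbasis_def W_def)
      then have "h b u = 0"
        using eig[of b] orth[OF b] herm_cnj[OF h, of b u] by simp
      moreover have "h b w = of_real (Re (h b b)) * ip b w"
        using B b spl(2)[OF v] by (simp add: eigenbasis_def w_def)
      moreover have "v = scale (ip v u) u + w" by (simp add: w_def)
      ultimately show ?thesis
        using orth[OF b]
        by (metis herm_add_right[OF h] herm_scale_right[OF h] herm_add_right[OF herm_form_ip]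
            herm_scale_right[OF herm_form_ip] mult_zero_right add_0)
    qed
    then have "\<forall>b\<in>insert u B. \<forall>v\<in>V. h b v = of_real (Re (h b b)) * ip b v"
      using eig by blast
    moreover have "finite (insert u B)" "insert u B \<subseteq> V"
      using B u(1) by (auto simp: eigenbasis_def W_def)
    moreover have "\<forall>b\<in>insert u B. \<forall>c\<in>insert u B. ip b c = (if b = c then 1 else 0)"
      using B u(2) orth by (auto simp: eigenbasis_def)
    ultimately have "eigenbasis V h (insert u B)"
      using sub unfolding eigenbasis_def by blast
    then show ?thesis ..
  qed
qed

section \<open>Counting eigenvalues by sign\<close>

definition form_eigen :: "'a set \<Rightarrow> ('a \<Rightarrow> 'a \<Rightarrow> complex) \<Rightarrow> real \<Rightarrow> 'a set"
  where "form_eigen V h l = {u \<in> V. \<forall>v\<in>V. h u v = of_real l * ip u v}"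

text \<open>The predicate \<open>Q\<close> selects the sign. Restricting to nonzero eigenspaces
  keeps the index set finite; a sum over an infinite set would be 0 by convention.\<close>

definition eigen_count :: "(real \<Rightarrow> bool) \<Rightarrow> 'a set \<Rightarrow> ('a \<Rightarrow> 'a \<Rightarrow> complex) \<Rightarrow> nat"
  where "eigen_count Q V h = (\<Sum>l | Q l \<and> form_eigen V h l \<noteq> {0}. dim (form_eigen V h l))"

lemma eigenbasisD:
  assumes "eigenbasis V h B"
  shows "finite B" "B \<subseteq> V" "V \<subseteq> span B" "\<And>b c. b \<in> B \<Longrightarrow> c \<in> B \<Longrightarrow> ip b c = (if b = c then 1 else 0)"
    "\<And>b v. b \<in> B \<Longrightarrow> v \<in> V \<Longrightarrow> h b v = of_real (Re (h b b)) * ip b v" "independent B"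
  using assms orthonormal_independent unfolding eigenbasis_def by blast+

lemma form_eigen_eq_span:
  assumes h: "herm_form h" and V: "subspace V" and B: "eigenbasis V h B"
  shows "form_eigen V h l = span {b \<in> B. Re (h b b) = l}"
proof
  have "subspace (form_eigen V h l)"
    using V herm_zero_left[OF herm_form_ip] herm_zero_left[OF h] unfolding form_eigen_def subspace_def
    by (auto simp: ip_add_left ip_scale_left herm_add_left[OF h] herm_scale_left[OF h] algebra_simps)
  moreover have "{b \<in> B. Re (h b b) = l} \<subseteq> form_eigen V h l"
    using eigenbasisD[OF B] by (auto simp: form_eigen_def)
  ultimately show "span {b \<in> B. Re (h b b) = l} \<subseteq> form_eigen V h l" by (rule span_minimal[rotated])
  show "form_eigen V h l \<subseteq> span {b \<in> B. Re (h b b) = l}"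
  proof
    fix u assume u: "u \<in> form_eigen V h l"
    have "u = (\<Sum>b\<in>B. scale (ip u b) b)"
      using u eigenbasisD[OF B] by (intro orthonormal_expansion) (auto simp: form_eigen_def)
    also have "\<dots> \<in> span {b \<in> B. Re (h b b) = l}"
    proof (rule span_sum)
      fix b assume b: "b \<in> B"
      show "scale (ip u b) b \<in> span {b \<in> B. Re (h b b) = l}"
      proof (cases "Re (h b b) = l")
        case True then show ?thesis using b by (intro span_scale span_base) auto
      next
        case False
        \<comment> \<open>Evaluating \<open>h u b\<close> through \<open>u\<close> and through
          \<open>b\<close> gives two different real multiples of \<open>ip u b\<close>, so this
          coefficient vanishes.\<close>
        have "h u b = of_real l * ip u b"
          using u b eigenbasisD(2)[OF B] by (auto simp: form_eigen_def)
        moreover have "h b u = of_real (Re (h b b)) * ip b u"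
          using u b eigenbasisD(5)[OF B] by (auto simp: form_eigen_def)
        then have "h u b = of_real (Re (h b b)) * ip u b"
          using herm_cnj[OF h, of u b] ip_cnj[of u b] by simp
        ultimately have "ip u b = 0" using False by auto
        then show ?thesis by (simp add: span_zero)
      qed
    qed
    finally show "u \<in> span {b \<in> B. Re (h b b) = l}" .
  qed
qed

lemma dim_form_eigen:
  assumes "herm_form h" "subspace V" "eigenbasis V h B"
  shows "dim (form_eigen V h l) = card {b \<in> B. Re (h b b) = l}"
proof -
  have "independent {b \<in> B. Re (h b b) = l}"
    using eigenbasisD(6)[OF assms(3)] independent_mono[of B] by auto
  then show ?thesis by (simp add: form_eigen_eq_span[OF assms] dim_eq_card_independent)
qed

text \<open>Each eigenspace is spanned by the basis vectors with that eigenvalue, so summing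
  dimensions regroups the basis by the value of \<open>Re (h b b)\<close>.\<close>

lemma eigen_count_eigenbasis:
  assumes h: "herm_form h" and V: "subspace V" and B: "eigenbasis V h B"
  shows "eigen_count Q V h = card {b \<in> B. Q (Re (h b b))}"
proof -
  note D = eigenbasisD[OF B]
  define S where "S = {b \<in> B. Q (Re (h b b))}"
  have S: "finite S" using D(1) by (simp add: S_def)
  have "form_eigen V h l \<noteq> {0} \<longleftrightarrow> l \<in> (\<lambda>b. Re (h b b)) ` B" for l
  proof -
    have "form_eigen V h l = {0} \<longleftrightarrow> {b \<in> B. Re (h b b) = l} = {}"
      using dim_form_eigen[OF assms, of l] form_eigen_eq_span[OF assms, of l] D(1)
      by (metis (no_types, lifting) card_0_eq card.empty dim_empty dim_span finite_subset
          mem_Collect_eq span_empty subsetI)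
    then show ?thesis by auto
  qed
  then have "{l. Q l \<and> form_eigen V h l \<noteq> {0}} = (\<lambda>b. Re (h b b)) ` S" by (auto simp: S_def)
  then have "eigen_count Q V h = (\<Sum>l\<in>(\<lambda>b. Re (h b b)) ` S. card {b \<in> S. Re (h b b) = l})"
    unfolding eigen_count_def dim_form_eigen[OF assms]
    by (auto intro!: sum.cong arg_cong[of _ _ card] simp: S_def)
  also have "\<dots> = card S"
    using sum.image_gen[OF S, of "\<lambda>_. 1::nat" "\<lambda>b. Re (h b b)"] by simp
  finally show ?thesis by (simp add: S_def)
qed

text \<open>In contrast to \<open>eigenbasis\<close>, orthogonality is required for \<open>h\<close>
  and not for \<open>ip\<close>. This notion survives injective linear maps that are not
  isometries.\<close>

definition diag_basis :: "'a set \<Rightarrow> ('a \<Rightarrow> 'a \<Rightarrow> complex) \<Rightarrow> 'a set \<Rightarrow> bool"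
  where "diag_basis V h C \<longleftrightarrow> independent C \<and> C \<subseteq> V \<and> V \<subseteq> span C \<and>
    (\<forall>b\<in>C. \<forall>c\<in>C. b \<noteq> c \<longrightarrow> h b c = 0)"

lemma eigenbasis_imp_diag_basis: "eigenbasis V h B \<Longrightarrow> diag_basis V h B"
  using eigenbasisD[of V h B] unfolding diag_basis_def
  by (metis mult_zero_right subsetD)

lemma herm_diagonal_eval:
  assumes h: "herm_form h" and fin: "finite C" and orth: "\<And>b c. b \<in> C \<Longrightarrow> c \<in> C \<Longrightarrow> b \<noteq> c \<Longrightarrow> h b c = 0"
  shows "Re (h (\<Sum>b\<in>C. scale (f b) b) (\<Sum>b\<in>C. scale (f b) b)) = (\<Sum>b\<in>C. (cmod (f b))\<^sup>2 * Re (h b b))"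
proof -
  have "h (\<Sum>b\<in>C. scale (f b) b) (\<Sum>b\<in>C. scale (f b) b)
      = (\<Sum>b\<in>C. \<Sum>c\<in>C. f b * (cnj (f c) * h b c))"
    unfolding herm_sum_left[OF h] herm_scale_left[OF h]
    unfolding herm_sum_right[OF h] herm_scale_right[OF h] sum_distrib_left ..
  also have "\<dots> = (\<Sum>b\<in>C. \<Sum>c\<in>C. if b = c then f b * (cnj (f c) * h b c) else 0)"
    using orth by (intro sum.cong) auto
  also have "\<dots> = (\<Sum>b\<in>C. of_real ((cmod (f b))\<^sup>2) * h b b)"
    using fin by (simp add: complex_norm_square mult.assoc del: of_real_power)
  finally show ?thesis by (simp flip: of_real_power)
qed

lemma span_neg_definite:
  assumes h: "herm_form h" and fin: "finite C" and orth: "\<And>b c. b \<in> C \<Longrightarrow> c \<in> C \<Longrightarrow> b \<noteq> c \<Longrightarrow> h b c = 0"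
    and neg: "\<And>b. b \<in> C \<Longrightarrow> Re (h b b) < 0" and w: "w \<in> span C" "w \<noteq> 0"
  shows "Re (h w w) < 0"
proof -
  obtain f where f: "w = (\<Sum>b\<in>C. scale (f b) b)" using w(1) span_finite[OF fin] by auto
  obtain b where b: "b \<in> C" "f b \<noteq> 0"
    using w(2) unfolding f by (metis (no_types, lifting) scale_zero_left sum.neutral)
  have "(\<Sum>b\<in>C. (cmod (f b))\<^sup>2 * Re (h b b)) < (\<Sum>b\<in>C. 0)"
    using fin b neg
    by (intro sum_strict_mono_ex1)
      (auto simp: mult_nonneg_nonpos less_imp_le intro!: bexI[of _ b] mult_pos_neg)
  then show ?thesis using herm_diagonal_eval[OF h fin orth, of f] by (simp add: f)
qed

lemma span_nonneg:
  assumes h: "herm_form h" and fin: "finite C" and orth: "\<And>b c. b \<in> C \<Longrightarrow> c \<in> C \<Longrightarrow> b \<noteq> c \<Longrightarrow> h b c = 0"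
    and nonneg: "\<And>b. b \<in> C \<Longrightarrow> Re (h b b) \<ge> 0" and w: "w \<in> span C"
  shows "Re (h w w) \<ge> 0"
proof -
  obtain f where f: "w = (\<Sum>b\<in>C. scale (f b) b)" using w(1) span_finite[OF fin] by auto
  show ?thesis using herm_diagonal_eval[OF h fin orth, of f] nonneg
    by (auto simp: f intro!: sum_nonneg)
qed

lemma dim_add_le:
  assumes "subspace S" "subspace T" "subspace V" "S \<subseteq> V" "T \<subseteq> V"
  shows "dim S + dim T \<le> dim V + dim (S \<inter> T)"
proof -
  have "{x + y |x y. x \<in> S \<and> y \<in> T} \<subseteq> V" using assms by (auto simp: subspace_add subset_iff)
  then have "dim {x + y |x y. x \<in> S \<and> y \<in> T} \<le> dim V" by (rule dim_subset)
  then show ?thesis using dim_sums_Int[OF assms(1,2)] by linarith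
qed

text \<open>Sylvester's law: the span of the negative vectors of \<open>C\<close> meets the span of
  the nonnegative vectors of \<open>D\<close> only in 0, and a dimension count finishes. Exchanging
  \<open>C\<close> and \<open>D\<close> gives equality.\<close>

lemma inertia_le:
  assumes h: "herm_form h" and V: "subspace V" and C: "diag_basis V h C" and D: "diag_basis V h D"
  shows "card {c \<in> C. Re (h c c) < 0} \<le> card {c \<in> D. Re (h c c) < 0}"
proof -
  let ?N = "{c \<in> C. Re (h c c) < 0}" and ?P = "{c \<in> D. \<not> Re (h c c) < 0}"
  have fin: "finite C" "finite D" using C D finiteI_independent by (auto simp: diag_basis_def)
  have ind: "independent ?N" "independent ?P"
    using C D independent_mono[of C ?N] independent_mono[of D ?P] by (auto simp: diag_basis_def)
  have sub: "span ?N \<subseteq> V" "span ?P \<subseteq> V"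
    using C D V unfolding diag_basis_def by (intro span_minimal; blast)+
  have "w = 0" if "w \<in> span ?N \<inter> span ?P" for w
  proof (rule ccontr)
    assume "w \<noteq> 0"
    have "Re (h w w) < 0"
      by (rule span_neg_definite[OF h, of ?N]) (use \<open>w \<noteq> 0\<close> that C fin in \<open>auto simp: diag_basis_def\<close>)
    moreover have "Re (h w w) \<ge> 0"
      by (rule span_nonneg[OF h, of ?P]) (use that D fin in \<open>auto simp: diag_basis_def\<close>)
    ultimately show False by simp
  qed
  then have "span ?N \<inter> span ?P \<subseteq> {0}" by blast
  then have "dim (span ?N \<inter> span ?P) = 0" by simp
  moreover have "dim (span ?N) = card ?N" "dim (span ?P) = card ?P"
    using ind by (simp_all add: dim_eq_card_independent)
  ultimately have "card ?N + card ?P \<le> dim V"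
    using dim_add_le[OF subspace_span subspace_span V sub] by linarith
  also have "dim V = card D" using D by (metis basis_card_eq_dim diag_basis_def)
  also have "\<dots> = card {c \<in> D. Re (h c c) < 0} + card ?P"
    using fin by (subst card_Un_disjoint[symmetric]) (auto intro!: arg_cong[of _ _ card])
  finally show ?thesis by simp
qed

lemma eigen_count_neg_diag_basis:
  assumes h: "herm_form h" and V: "subspace V" and C: "diag_basis V h C"
  shows "eigen_count (\<lambda>l. l < 0) V h = card {c \<in> C. Re (h c c) < 0}"
proof -
  obtain B where B: "eigenbasis V h B" using eigenbasis_exists[OF h V] ..
  then show ?thesis
    using eigen_count_eigenbasis[OF h V B] inertia_le[OF h V] C eigenbasis_imp_diag_basis
    by (simp add: antisym)
qed

lemma eigenbasis_uminus: "eigenbasis V h B \<Longrightarrow> eigenbasis V (\<lambda>u v. - h u v) B"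
  by (auto simp: eigenbasis_def)

text \<open>The same eigenbasis serves \<open>h\<close> and its negative. Later statements about
  positive eigenvalues are reduced to negative ones in this way.\<close>

lemma eigen_count_pos_uminus:
  assumes h: "herm_form h" and V: "subspace V"
  shows "eigen_count (\<lambda>l. l > 0) V h = eigen_count (\<lambda>l. l < 0) V (\<lambda>u v. - h u v)"
proof -
  obtain B where B: "eigenbasis V h B" using eigenbasis_exists[OF h V] ..
  show ?thesis
    using eigen_count_eigenbasis[OF h V B]
      eigen_count_eigenbasis[OF herm_uminus[OF h] V eigenbasis_uminus[OF B]] by simp
qed

lemma eigen_count_total:
  assumes h: "herm_form h" and V: "subspace V"
  shows "eigen_count (\<lambda>l. l < 0) V h + eigen_count (\<lambda>l. l > 0) V h + dim (form_eigen V h 0) = dim V"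
proof -
  obtain B where B: "eigenbasis V h B" using eigenbasis_exists[OF h V] ..
  note D = eigenbasisD[OF B]
  have "dim V = card B" using D by (metis basis_card_eq_dim)
  also have "card B = card ({b \<in> B. Re (h b b) < 0} \<union> {b \<in> B. Re (h b b) > 0} \<union> {b \<in> B. Re (h b b) = 0})"
    by (rule arg_cong[of _ _ card]) auto
  also have "\<dots> = card {b \<in> B. Re (h b b) < 0} + card {b \<in> B. Re (h b b) > 0} + card {b \<in> B. Re (h b b) = 0}"
  proof -
    have "card ({b \<in> B. Re (h b b) < 0} \<union> {b \<in> B. Re (h b b) > 0})
        = card {b \<in> B. Re (h b b) < 0} + card {b \<in> B. Re (h b b) > 0}"
      using D(1) by (intro card_Un_disjoint) auto
    then show ?thesis
      using D(1) by (subst card_Un_disjoint) auto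
  qed
  finally show ?thesis
    using eigen_count_eigenbasis[OF h V B] dim_form_eigen[OF h V B] by simp
qed

section \<open>Subadditivity of the negative index\<close>

lemma neg_subspace:
  assumes h: "herm_form h" and V: "subspace V"
  obtains N where "subspace N" "N \<subseteq> V" "dim N = eigen_count (\<lambda>l. l < 0) V h"
    "\<And>w. w \<in> N \<Longrightarrow> w \<noteq> 0 \<Longrightarrow> Re (h w w) < 0"
proof -
  obtain B where B: "eigenbasis V h B" using eigenbasis_exists[OF h V] ..
  note D = eigenbasisD[OF B]
  let ?N = "{c \<in> B. Re (h c c) < 0}"
  have orth: "h b c = 0" if "b \<in> B" "c \<in> B" "b \<noteq> c" for b c
    using eigenbasis_imp_diag_basis[OF B] that by (simp add: diag_basis_def)
  have "independent ?N" using D(6) independent_mono[of B] by auto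
  then have dim: "dim (span ?N) = eigen_count (\<lambda>l. l < 0) V h"
    using eigen_count_eigenbasis[OF h V B] by (simp add: dim_eq_card_independent)
  have sub: "span ?N \<subseteq> V"
    using D(2) V by (intro span_minimal) auto
  have "Re (h w w) < 0" if "w \<in> span ?N" "w \<noteq> 0" for w
    by (rule span_neg_definite[OF h, of ?N]) (use that D(1) orth in auto)
  then show thesis using that[OF subspace_span sub dim] by blast
qed

lemma nonneg_subspace:
  assumes h: "herm_form h" and V: "subspace V"
  obtains P where "subspace P" "P \<subseteq> V" "dim P + eigen_count (\<lambda>l. l < 0) V h = dim V"
    "\<And>w. w \<in> P \<Longrightarrow> Re (h w w) \<ge> 0"
proof -
  obtain B where B: "eigenbasis V h B" using eigenbasis_exists[OF h V] ..
  note D = eigenbasisD[OF B]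
  let ?N = "{c \<in> B. Re (h c c) < 0}" and ?P = "{c \<in> B. \<not> Re (h c c) < 0}"
  have orth: "h b c = 0" if "b \<in> B" "c \<in> B" "b \<noteq> c" for b c
    using eigenbasis_imp_diag_basis[OF B] that by (simp add: diag_basis_def)
  have "dim V = card B" using D by (metis basis_card_eq_dim)
  also have "\<dots> = card ?N + card ?P"
    using D(1) by (subst card_Un_disjoint[symmetric]) (auto intro!: arg_cong[of _ _ card])
  finally have "dim V = card ?N + card ?P" .
  moreover have "independent ?P" using D(6) independent_mono[of B] by auto
  ultimately have dim: "dim (span ?P) + eigen_count (\<lambda>l. l < 0) V h = dim V"
    using eigen_count_eigenbasis[OF h V B] by (simp add: dim_eq_card_independent)
  have sub: "span ?P \<subseteq> V"
    using D(2) V by (intro span_minimal) auto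
  have "Re (h w w) \<ge> 0" if "w \<in> span ?P" for w
    by (rule span_nonneg[OF h, of ?P]) (use that D(1) orth in auto)
  then show thesis using that[OF subspace_span sub dim] by blast
qed

text \<open>A subspace \<open>N\<close> on which the sum is negative definite meets
  \<open>P \<inter> Q\<close> trivially, where \<open>P\<close> and \<open>Q\<close> are nonnegative
  for \<open>h\<close> and \<open>g\<close>. The codimensions of \<open>P\<close> and
  \<open>Q\<close> are the two counts on the right.\<close>

lemma eigen_count_neg_add_le:
  assumes h: "herm_form h" and g: "herm_form g" and V: "subspace V"
  shows "eigen_count (\<lambda>l. l < 0) V (\<lambda>u v. h u v + g u v)
    \<le> eigen_count (\<lambda>l. l < 0) V h + eigen_count (\<lambda>l. l < 0) V g"
proof -
  have hg: "herm_form (\<lambda>u v. h u v + g u v)"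
    by (rule herm_formI)
      (simp_all add: herm_add_left[OF h] herm_scale_left[OF h] herm_add_left[OF g]
        herm_scale_left[OF g] algebra_simps flip: herm_cnj[OF h] herm_cnj[OF g])
  obtain N where N: "subspace N" "N \<subseteq> V" "dim N = eigen_count (\<lambda>l. l < 0) V (\<lambda>u v. h u v + g u v)"
    "\<And>w. w \<in> N \<Longrightarrow> w \<noteq> 0 \<Longrightarrow> Re (h w w + g w w) < 0"
    using neg_subspace[OF hg V] by blast
  obtain P where P: "subspace P" "P \<subseteq> V" "dim P + eigen_count (\<lambda>l. l < 0) V h = dim V"
    "\<And>w. w \<in> P \<Longrightarrow> Re (h w w) \<ge> 0"
    using nonneg_subspace[OF h V] by blast
  obtain Q where Q: "subspace Q" "Q \<subseteq> V" "dim Q + eigen_count (\<lambda>l. l < 0) V g = dim V"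
    "\<And>w. w \<in> Q \<Longrightarrow> Re (g w w) \<ge> 0"
    using nonneg_subspace[OF g V] by blast
  have "w = 0" if "w \<in> N \<inter> (P \<inter> Q)" for w
  proof (rule ccontr)
    assume "w \<noteq> 0"
    then show False using that N(4)[of w] P(4)[of w] Q(4)[of w] by simp
  qed
  then have "N \<inter> (P \<inter> Q) \<subseteq> {0}" by blast
  then have "dim (N \<inter> (P \<inter> Q)) = 0" by simp
  moreover have "dim P + dim Q \<le> dim V + dim (P \<inter> Q)"
    using P Q V by (intro dim_add_le) auto
  moreover have "dim N + dim (P \<inter> Q) \<le> dim V + dim (N \<inter> (P \<inter> Q))"
    using P Q N V by (intro dim_add_le subspace_inter) auto
  ultimately show ?thesis using N(3) P(3) Q(3) by linarith
qed

end

section \<open>Hermitian matrices and block diagonal forms\<close>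

lemma cinner_add_left: "cinner (x + y) z = cinner x z + cinner y z"
  by (simp add: cinner_def sum.distrib algebra_simps)

lemma cinner_scale_left: "cinner (c *s x) z = c * cinner x z"
  by (simp add: cinner_def sum_distrib_left algebra_simps)

lemma cinner_cnj: "cinner y x = cnj (cinner x y)"
  by (simp add: cinner_def mult.commute)

lemma Re_cinner: "Re (cinner x y) = x \<bullet> y"
  by (simp add: cinner_def inner_vec_def inner_complex_def)

interpretation cv: hermitian_space
  "(*s) :: complex \<Rightarrow> complex^'n::finite \<Rightarrow> complex^'n" cart_basis cinner
  by unfold_locales (rule cinner_add_left cinner_scale_left cinner_cnj Re_cinner)+

lemmas cinner_add_right = cv.herm_add_right[OF cv.herm_form_ip]
  and cinner_scale_right = cv.herm_scale_right[OF cv.herm_form_ip]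
  and cinner_zero_left [simp] = cv.herm_zero_left[OF cv.herm_form_ip]
  and cinner_zero_right [simp] = cv.herm_zero_right[OF cv.herm_form_ip]

lemma cinner_minus_left: "cinner (- x) z = - cinner x z"
  by (simp add: cinner_def sum_negf)

lemma cinner_diff_left: "cinner (x - y) z = cinner x z - cinner y z"
  by (simp add: cinner_def sum_subtractf algebra_simps)

lemma cinner_diff_right: "cinner z (x - y) = cinner z x - cinner z y"
  by (simp add: cinner_def sum_subtractf algebra_simps)

lemma cinner_minus_right: "cinner z (- x) = - cinner z x"
  by (simp add: cinner_def sum_negf)

lemmas cinner_simps = cinner_add_left cinner_add_right cinner_diff_left cinner_diff_right
  cinner_scale_left cinner_scale_right cinner_minus_left cinner_minus_right

lemma cinner6_alt: "cinner6 u v = cinner2 (fst u) (fst v) + cinner2 (fst (snd u)) (fst (snd v))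
    + cinner2 (snd (snd u)) (snd (snd v))"
  by (cases u; cases v) (auto split: prod.splits)

lemma Omega_alt: "Omega u v = omega (fst u) (fst (snd v)) + omega (fst (snd u)) (snd (snd v))
    + omega (snd (snd u)) (fst v) - omega (fst (snd u)) (fst v) - omega (snd (snd u)) (fst (snd v))
    - omega (fst u) (snd (snd v))"
  by (cases u; cases v) (auto split: prod.splits)

interpretation sp6h: hermitian_space
  "scale6 :: complex \<Rightarrow> 'n::finite triple \<Rightarrow> 'n triple" basis6 cinner6
proof
  fix u v w :: "'n triple" and c :: complex
  show "cinner6 (u + v) w = cinner6 u w + cinner6 v w"
    by (simp add: cinner6_alt cinner2_def cinner_add_left)
  show "cinner6 (scale6 c u) w = c * cinner6 u w"
    by (simp add: cinner6_alt cinner2_def scale6_def scale2_def cinner_scale_left algebra_simps)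
  show "cinner6 v u = cnj (cinner6 u v)"
    by (simp add: cinner6_alt cinner2_def flip: cinner_cnj)
  show "Re (cinner6 u v) = u \<bullet> v"
    by (simp add: cinner6_alt cinner2_def inner_prod_def Re_cinner)
qed

lemma form_n_minus_eq: "form_n_minus V h = sp6h.eigen_count (\<lambda>l. l < 0) V h"
  by (simp add: form_n_minus_def sp6h.eigen_count_def form_eigenspace_def sp6h.form_eigen_def)

lemma form_n_plus_eq: "form_n_plus V h = sp6h.eigen_count (\<lambda>l. l > 0) V h"
  by (simp add: form_n_plus_def sp6h.eigen_count_def form_eigenspace_def sp6h.form_eigen_def)

section \<open>Sign reversal and transport of inertia along linear maps\<close>

lemma form_n_plus_uminus:
  assumes "sp6h.herm_form h" "sp6.subspace V"
  shows "form_n_plus V h = form_n_minus V (\<lambda>u v. - h u v)"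
  using sp6h.eigen_count_pos_uminus[OF assms] by (simp add: form_n_plus_eq form_n_minus_eq)

text \<open>The map \<open>\<phi>\<close> need not respect the inner product, so eigenvectors are
  not preserved. It does carry a basis diagonalising \<open>g\<close> to one diagonalising
  \<open>h\<close> with the same diagonal values, and by Sylvester's law that determines the
  count.\<close>

lemma form_n_minus_image:
  assumes lin: "Vector_Spaces.linear scale6 scale6 \<phi>" and V: "sp6.subspace V" and inj: "inj_on \<phi> V"
    and h: "sp6h.herm_form h" and g: "sp6h.herm_form g"
    and eq: "\<And>u v. u \<in> V \<Longrightarrow> v \<in> V \<Longrightarrow> h (\<phi> u) (\<phi> v) = g u v"
  shows "form_n_minus (\<phi> ` V) h = form_n_minus V g"
proof -
  interpret l: Vector_Spaces.linear scale6 scale6 \<phi> by (rule lin)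
  interpret p: vector_space_pair scale6 scale6 ..
  obtain B where "sp6h.eigenbasis V g B" using sp6h.eigenbasis_exists[OF g V] ..
  then have B: "sp6h.diag_basis V g B" by (rule sp6h.eigenbasis_imp_diag_basis)
  then have BV: "B \<subseteq> V" and spB: "sp6.span B = V"
    using V by (auto simp: sp6h.diag_basis_def intro: sp6.span_minimal[THEN subsetD])
  have "sp6.independent (\<phi> ` B)"
    using B inj spB p.linear_independent_injective_image[OF lin, of B] by (simp add: sp6h.diag_basis_def)
  moreover have "h (\<phi> b) (\<phi> c) = 0" if "b \<in> B" "c \<in> B" "\<phi> b \<noteq> \<phi> c" for b c
  proof -
    have "b \<in> V" "c \<in> V" "b \<noteq> c" using that BV by auto
    then show ?thesis using B that eq[of b c] by (simp add: sp6h.diag_basis_def)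
  qed
  ultimately have C: "sp6h.diag_basis (\<phi> ` V) h (\<phi> ` B)"
    using BV spB l.span_image[of B] by (auto simp: sp6h.diag_basis_def)
  have W: "sp6.subspace (\<phi> ` V)" using V by (rule l.subspace_image)
  have "{c \<in> \<phi> ` B. Re (h c c) < 0} = \<phi> ` {b \<in> B. Re (g b b) < 0}"
    using eq BV by (auto simp: subset_iff)
  then have "card {c \<in> \<phi> ` B. Re (h c c) < 0} = card {b \<in> B. Re (g b b) < 0}"
    using inj BV by (metis (no_types, lifting) card_image inj_on_subset mem_Collect_eq subsetD subsetI)
  then show ?thesis
    using sp6h.eigen_count_neg_diag_basis[OF h W C] sp6h.eigen_count_neg_diag_basis[OF g V B]
    by (simp add: form_n_minus_eq)
qed

lemma form_n_plus_image:
  assumes lin: "Vector_Spaces.linear scale6 scale6 \<phi>" and V: "sp6.subspace V" and inj: "inj_on \<phi> V"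
    and h: "sp6h.herm_form h" and g: "sp6h.herm_form g"
    and eq: "\<And>u v. u \<in> V \<Longrightarrow> v \<in> V \<Longrightarrow> h (\<phi> u) (\<phi> v) = g u v"
  shows "form_n_plus (\<phi> ` V) h = form_n_plus V g"
proof -
  interpret l: Vector_Spaces.linear scale6 scale6 \<phi> by (rule lin)
  have "sp6.subspace (\<phi> ` V)" using V by (rule l.subspace_image)
  then show ?thesis
    using form_n_minus_image[OF lin V inj sp6h.herm_uminus[OF h] sp6h.herm_uminus[OF g]] eq
    by (simp add: form_n_plus_uminus h g V)
qed

section \<open>Hermitian matrices as forms\<close>

definition mat_form :: "complex^'n^'n::finite \<Rightarrow> complex^'n \<Rightarrow> complex^'n \<Rightarrow> complex"
  where "mat_form A u v = cinner (A *v u) v"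

lemma cinner_hermitian:
  assumes "hermitian A"
  shows "cinner x (A *v y) = cinner (A *v x) y"
proof -
  have h: "cnj (A $ i $ j) = A $ j $ i" for i j
    using assms unfolding hermitian_def by metis
  have "cinner x (A *v y) = (\<Sum>i\<in>UNIV. \<Sum>j\<in>UNIV. x $ i * (cnj (A $ i $ j) * cnj (y $ j)))"
    by (simp add: cinner_def matrix_vector_mult_def sum_distrib_left)
  also have "\<dots> = (\<Sum>j\<in>UNIV. \<Sum>i\<in>UNIV. A $ j $ i * x $ i * cnj (y $ j))"
    by (subst sum.swap) (simp add: h ac_simps)
  also have "\<dots> = cinner (A *v x) y"
    by (simp add: cinner_def matrix_vector_mult_def sum_distrib_right)
  finally show ?thesis .
qed

lemma herm_form_mat_form:
  assumes "hermitian A"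
  shows "cv.herm_form (mat_form A)"
  unfolding mat_form_def
proof (rule cv.herm_formI)
  show "cinner (A *v v) u = cnj (cinner (A *v u) v)" for u v
    using cinner_hermitian[OF assms, of v u] by (metis cinner_cnj)
qed (simp_all add: matrix_vector_right_distrib cinner_add_left vec.scale cinner_scale_left vector_scalar_commute)

text \<open>Nondegeneracy of \<open>cinner\<close> turns the weak eigenvector equation into the
  matrix one: the difference of the two sides is orthogonal to every vector, in particular to
  itself.\<close>

lemma form_eigen_mat_form: "cv.form_eigen UNIV (mat_form A) l = mat_eigenspace A l"
proof -
  have "A *v x = complex_of_real l *s x"
    if "\<And>v. cinner (A *v x) v = complex_of_real l * cinner x v" for x
  proof -
    have "cinner (A *v x - complex_of_real l *s x) v = 0" for v
      using that by (simp add: cinner_simps)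
    then have "norm (A *v x - complex_of_real l *s x) = 0"
      by (metis Re_cinner norm_eq_zero inner_eq_zero_iff zero_complex.sel(1))
    then show ?thesis by simp
  qed
  then have "(\<forall>v. cinner (A *v x) v = complex_of_real l * cinner x v)
      \<longleftrightarrow> A *v x = complex_of_real l *s x" for x
    by (metis cinner_scale_left)
  then show ?thesis
    by (simp add: cv.form_eigen_def mat_form_def mat_eigenspace_def)
qed

lemma mat_n_minus_eq: "mat_n_minus A = cv.eigen_count (\<lambda>l. l < 0) UNIV (mat_form A)"
  by (simp add: mat_n_minus_def cv.eigen_count_def form_eigen_mat_form)

lemma hermitian_uminus: "hermitian A \<Longrightarrow> hermitian (- A)"
  by (metis (no_types, lifting) complex_cnj_minus hermitian_def vector_uminus_component)

lemma hermitian_diff: "hermitian A \<Longrightarrow> hermitian B \<Longrightarrow> hermitian (A - B)"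
  by (metis (no_types, lifting) complex_cnj_diff hermitian_def vector_minus_component)

lemma mat_form_uminus: "mat_form (- A) = (\<lambda>u v. - mat_form A u v)"
  by (simp add: fun_eq_iff mat_form_def cinner_def matrix_vector_mult_def sum_negf)

lemma mat_form_add: "mat_form (A + B) = (\<lambda>u v. mat_form A u v + mat_form B u v)"
  by (simp add: fun_eq_iff mat_form_def matrix_vector_mult_add_rdistrib cinner_add_left)

lemma mat_n_minus_uminus:
  assumes "hermitian A"
  shows "mat_n_minus (- A) = cv.eigen_count (\<lambda>l. l > 0) UNIV (mat_form A)"
  using cv.eigen_count_pos_uminus[OF herm_form_mat_form[OF assms] vec.subspace_UNIV]
  by (simp add: mat_n_minus_eq mat_form_uminus)

text \<open>Negative, positive and zero eigenvalues exhaust the dimension; the positive ones of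
  \<open>A\<close> are the negative ones of \<open>- A\<close>, and the eigenspace for 0 is the
  kernel.\<close>

lemma mat_n_minus_total:
  fixes A :: "complex^'n^'n::finite"
  assumes "hermitian A"
  shows "mat_n_minus A + mat_n_minus (- A) + vec.dim {x. A *v x = 0} = CARD('n)"
proof -
  have "vec.dim (UNIV :: (complex^'n) set) = CARD('n)" by (rule vec_dim_card)
  then show ?thesis
    using cv.eigen_count_total[OF herm_form_mat_form[OF assms] vec.subspace_UNIV]
      mat_n_minus_uminus[OF assms] mat_n_minus_eq[of A]
    by (simp add: form_eigen_mat_form mat_eigenspace_def)
qed

lemma mat_n_minus_add_le:
  assumes "hermitian A" "hermitian B"
  shows "mat_n_minus (A + B) \<le> mat_n_minus A + mat_n_minus B"
  using cv.eigen_count_neg_add_le[OF assms[THEN herm_form_mat_form] vec.subspace_UNIV]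
  by (simp add: mat_n_minus_eq mat_form_add)

definition block_form ::
    "complex^'n^'n::finite \<Rightarrow> complex^'n^'n \<Rightarrow> complex^'n^'n \<Rightarrow> 'n triple \<Rightarrow> 'n triple \<Rightarrow> complex"
  where "block_form A B C u v = 2 * (mat_form A (fst (fst u)) (fst (fst v))
    + mat_form B (fst (fst (snd u))) (fst (fst (snd v)))
    + mat_form C (fst (snd (snd u))) (fst (snd (snd v))))"

lemma herm_form_block_form:
  assumes "hermitian A" "hermitian B" "hermitian C"
  shows "sp6h.herm_form (block_form A B C)"
proof -
  note H = assms[THEN herm_form_mat_form]
  show ?thesis
    unfolding block_form_def
    by (rule sp6h.herm_formI)
      (simp_all add: scale6_def scale2_def H[THEN cv.herm_add_left] H[THEN cv.herm_scale_left]
        algebra_simps flip: H[THEN cv.herm_cnj])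
qed

text \<open>A copy of three summands \<open>complex^'n\<close> inside the type of triples. With it
  the parameter space has the same type as the domain of \<open>Omega\<close>, so
  \<open>form_n_minus\<close> applies on both sides.\<close>

definition horizontal :: "'n::finite triple set"
  where "horizontal = graph 0 \<times> graph 0 \<times> graph 0"

lemma mem_horizontal: "u \<in> horizontal \<longleftrightarrow> (\<exists>a b c. u = ((a, 0), (b, 0), (c, 0)))"
  by (auto simp: horizontal_def graph_def)

lemma subspace_horizontal: "sp6.subspace horizontal"
  unfolding sp6.subspace_def
  by (auto simp: mem_horizontal scale6_def scale2_def zero_prod_def)

text \<open>Eigenbases of the three matrices, embedded in their own slots, together form an
  orthonormal basis that diagonalises the block form. The factor 2 does not affect signs.\<close>

lemma form_n_minus_block_form:
  fixes A B C :: "complex^'n^'n::finite"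
  assumes "hermitian A" "hermitian B" "hermitian C"
  shows "form_n_minus horizontal (block_form A B C) = mat_n_minus A + mat_n_minus B + mat_n_minus C"
proof -
  note H = assms[THEN herm_form_mat_form]
  obtain E F G where E: "cv.eigenbasis UNIV (mat_form A) E" and F: "cv.eigenbasis UNIV (mat_form B) F"
    and G: "cv.eigenbasis UNIV (mat_form C) G"
    using H[THEN cv.eigenbasis_exists] vec.subspace_UNIV by metis
  note DE = cv.eigenbasisD[OF E] and DF = cv.eigenbasisD[OF F] and DG = cv.eigenbasisD[OF G]
  define e f g :: "complex^'n \<Rightarrow> 'n triple" where "e = (\<lambda>x. ((x, 0), (0, 0), (0, 0)))"
    and "f = (\<lambda>x. ((0, 0), (x, 0), (0, 0)))" and "g = (\<lambda>x. ((0, 0), (0, 0), (x, 0)))"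
  interpret ve: Vector_Spaces.linear "(*s)" scale6 e
    by unfold_locales (auto simp: e_def scale6_def scale2_def)
  interpret vf: Vector_Spaces.linear "(*s)" scale6 f
    by unfold_locales (auto simp: f_def scale6_def scale2_def)
  interpret vg: Vector_Spaces.linear "(*s)" scale6 g
    by unfold_locales (auto simp: g_def scale6_def scale2_def)
  let ?X = "e ` E \<union> f ` F \<union> g ` G"
  have inj: "inj e" "inj f" "inj g" by (auto simp: inj_def e_def f_def g_def)
  \<comment> \<open>The three embeddings agree at 0 only, so this makes the images of the three
    bases disjoint.\<close>
  have nz: "0 \<notin> E" "0 \<notin> F" "0 \<notin> G" using DE(4) DF(4) DG(4) by force+
  have on: "cinner6 b c = (if b = c then 1 else 0)" if "b \<in> ?X" "c \<in> ?X" for b c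
    using that DE(4) DF(4) DG(4) nz
    by (auto simp: e_def f_def g_def cinner2_def split: if_splits)
  have fin: "finite ?X" using DE(1) DF(1) DG(1) by auto
  have "u \<in> sp6.span ?X" if u: "u \<in> horizontal" for u
  proof -
    obtain a b c where abc: "u = ((a, 0), (b, 0), (c, 0))" using u by (auto simp: mem_horizontal)
    have "e a \<in> sp6.span (e ` E)" "f b \<in> sp6.span (f ` F)" "g c \<in> sp6.span (g ` G)"
      using DE(3) DF(3) DG(3) by (auto simp: ve.span_image vf.span_image vg.span_image)
    then have "e a \<in> sp6.span ?X" "f b \<in> sp6.span ?X" "g c \<in> sp6.span ?X"
      using sp6.span_mono[of "e ` E" ?X] sp6.span_mono[of "f ` F" ?X] sp6.span_mono[of "g ` G" ?X] by auto
    then have "e a + f b + g c \<in> sp6.span ?X" by (intro sp6.span_add)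
    then show ?thesis by (simp add: abc e_def f_def g_def)
  qed
  moreover have "?X \<subseteq> horizontal" by (auto simp: mem_horizontal e_def f_def g_def)
  moreover have "block_form A B C b c = 0" if "b \<in> ?X" "c \<in> ?X" "b \<noteq> c" for b c
  proof -
    have "mat_form A 0 x = 0" "mat_form B 0 x = 0" "mat_form C 0 x = 0"
      "mat_form A x 0 = 0" "mat_form B x 0 = 0" "mat_form C x 0 = 0" for x
      by (simp_all add: mat_form_def)
    moreover have "x \<in> E \<Longrightarrow> y \<in> E \<Longrightarrow> x \<noteq> y \<Longrightarrow> mat_form A x y = 0"
      "x \<in> F \<Longrightarrow> y \<in> F \<Longrightarrow> x \<noteq> y \<Longrightarrow> mat_form B x y = 0"
      "x \<in> G \<Longrightarrow> y \<in> G \<Longrightarrow> x \<noteq> y \<Longrightarrow> mat_form C x y = 0" for x y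
      using cv.eigenbasis_imp_diag_basis[OF E] cv.eigenbasis_imp_diag_basis[OF F]
        cv.eigenbasis_imp_diag_basis[OF G] by (simp_all add: cv.diag_basis_def)
    ultimately show ?thesis
      using that by (elim UnE imageE) (simp_all add: e_def f_def g_def block_form_def)
  qed
  ultimately have X: "sp6h.diag_basis horizontal (block_form A B C) ?X"
    using sp6h.orthonormal_independent[OF fin on] by (auto simp: sp6h.diag_basis_def)
  define N where "N = (\<lambda>S. {x \<in> S. Re (block_form A B C x x) < 0})"
  have disj: "N (e ` E) \<inter> N (f ` F) = {}" "(N (e ` E) \<union> N (f ` F)) \<inter> N (g ` G) = {}"
    using nz by (auto simp: N_def e_def f_def g_def)
  have fins: "finite (N (e ` E))" "finite (N (f ` F))" "finite (N (g ` G))"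
    using DE(1) DF(1) DG(1) by (auto simp: N_def)
  have "N (e ` E) = e ` {b \<in> E. Re (mat_form A b b) < 0}"
    "N (f ` F) = f ` {b \<in> F. Re (mat_form B b b) < 0}"
    "N (g ` G) = g ` {b \<in> G. Re (mat_form C b b) < 0}"
    by (auto simp: N_def e_def f_def g_def block_form_def) (auto simp: mat_form_def)
  then have cards: "card (N (e ` E)) = mat_n_minus A" "card (N (f ` F)) = mat_n_minus B"
    "card (N (g ` G)) = mat_n_minus C"
    using inj[THEN inj_on_subset, OF subset_UNIV]
      cv.eigen_count_eigenbasis[OF H(1) vec.subspace_UNIV E]
      cv.eigen_count_eigenbasis[OF H(2) vec.subspace_UNIV F]
      cv.eigen_count_eigenbasis[OF H(3) vec.subspace_UNIV G]
    by (simp_all add: card_image mat_n_minus_eq)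
  have "N ?X = N (e ` E) \<union> N (f ` F) \<union> N (g ` G)" by (auto simp: N_def)
  then have "card (N ?X) = mat_n_minus A + mat_n_minus B + mat_n_minus C"
    using disj fins cards by (simp add: card_Un_disjoint)
  then show ?thesis
    using sp6h.eigen_count_neg_diag_basis[OF herm_form_block_form[OF assms] subspace_horizontal X]
    by (simp add: form_n_minus_eq N_def)
qed

lemma form_n_plus_block_form:
  assumes "hermitian A" "hermitian B" "hermitian C"
  shows "form_n_plus horizontal (block_form A B C)
    = mat_n_minus (- A) + mat_n_minus (- B) + mat_n_minus (- C)"
proof -
  have "(\<lambda>u v. - block_form A B C u v) = block_form (- A) (- B) (- C)"
    by (simp add: fun_eq_iff block_form_def mat_form_uminus algebra_simps)
  then show ?thesis
    using form_n_minus_block_form[OF assms[THEN hermitian_uminus]]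
    by (simp add: form_n_plus_uminus herm_form_block_form[OF assms] subspace_horizontal)
qed

section \<open>The form \<open>\<Omega>\<close> on graphs\<close>

lemma herm_form_Omega: "sp6h.herm_form Omega"
proof (rule sp6h.herm_formI)
  show "Omega v u = cnj (Omega u v)" for u v :: "'a triple"
    by (simp add: Omega_alt omega_def flip: cinner_cnj)
qed (simp_all add: Omega_alt omega_def scale6_def scale2_def cinner_simps algebra_simps)

lemma
  fixes A1 A2 A3 :: "complex^'n^'n::finite"
  assumes A: "hermitian A1" "hermitian A2" "hermitian A3"
  shows form_n_minus_graphs: "form_n_minus (graph A1 \<times> graph A2 \<times> graph A3) Omega
      = mat_n_minus (A3 - A2) + mat_n_minus (A1 - A3) + mat_n_minus (A2 - A1)"
    and form_n_plus_graphs: "form_n_plus (graph A1 \<times> graph A2 \<times> graph A3) Omega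
      = mat_n_minus (A2 - A3) + mat_n_minus (A3 - A1) + mat_n_minus (A1 - A2)"
proof -
  define \<phi> :: "'n triple \<Rightarrow> 'n triple" where
    "\<phi> = (\<lambda>u. let a = fst (fst u); b = fst (fst (snd u)); c = fst (snd (snd u))
       in ((b + c, A1 *v (b + c)), (a + c, A2 *v (a + c)), (a + b, A3 *v (a + b))))"
  have lin: "Vector_Spaces.linear scale6 scale6 \<phi>"
    by unfold_locales
      (simp_all add: \<phi>_def Let_def scale6_def scale2_def vec.scale_right_distrib
        matrix_vector_right_distrib vector_scalar_commute add_ac)
  have inj: "inj_on \<phi> horizontal"
  proof (rule inj_onI)
    fix u v assume uv: "u \<in> horizontal" "v \<in> horizontal" and eq: "\<phi> u = \<phi> v"
    obtain a b c where u: "u = ((a, 0), (b, 0), (c, 0))" using uv by (auto simp: mem_horizontal)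
    obtain a' b' c' where v: "v = ((a', 0), (b', 0), (c', 0))" using uv by (auto simp: mem_horizontal)
    have e: "b + c = b' + c'" "a + c = a' + c'" "a + b = a' + b'"
      using eq by (auto simp: u v \<phi>_def)
    \<comment> \<open>The pairwise sums determine \<open>a\<close>, and then \<open>b\<close> and
      \<open>c\<close>.\<close>
    have "2 *\<^sub>R a = (a + c) + (a + b) - (b + c)" "2 *\<^sub>R a' = (a' + c') + (a' + b') - (b' + c')"
      by (simp_all add: scaleR_2)
    then have "2 *\<^sub>R a = 2 *\<^sub>R a'" using e by metis
    then have "a = a'" by simp
    then show "u = v" using e by (simp add: u v)
  qed
  have im: "\<phi> ` horizontal = graph A1 \<times> graph A2 \<times> graph A3"
  proof
    show "\<phi> ` horizontal \<subseteq> graph A1 \<times> graph A2 \<times> graph A3"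
      by (auto simp: \<phi>_def graph_def Let_def)
    show "graph A1 \<times> graph A2 \<times> graph A3 \<subseteq> \<phi> ` horizontal"
    proof
      fix w assume "w \<in> graph A1 \<times> graph A2 \<times> graph A3"
      then obtain x y z where w: "w = ((x, A1 *v x), (y, A2 *v y), (z, A3 *v z))"
        by (auto simp: graph_def)
      define a b c where "a = (1/2) *\<^sub>R (y + z - x)" and "b = (1/2) *\<^sub>R (x + z - y)"
        and "c = (1/2) *\<^sub>R (x + y - z)"
      have "b + c = x" "a + c = y" "a + b = z"
        by (simp_all add: a_def b_def c_def flip: scaleR_right_distrib scaleR_2)
      then have "w = \<phi> ((a, 0), (b, 0), (c, 0))" by (simp add: w \<phi>_def)
      moreover have "((a, 0), (b, 0), (c, 0)) \<in> horizontal" by (auto simp: mem_horizontal)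
      ultimately show "w \<in> \<phi> ` horizontal" by blast
    qed
  qed
  \<comment> \<open>The mixed terms in \<open>a\<close>, \<open>b\<close>, \<open>c\<close> occur
    with the same coefficients for each of the differences \<open>A3 - A2\<close>,
    \<open>A1 - A3\<close>, \<open>A2 - A1\<close>. These differences add up to 0, so only the
    diagonal blocks remain.\<close>
  have eq: "Omega (\<phi> u) (\<phi> v) = block_form (A3 - A2) (A1 - A3) (A2 - A1) u v" for u v
    by (simp add: Omega_alt omega_def \<phi>_def Let_def block_form_def mat_form_def cinner_simps
        matrix_vector_right_distrib matrix_vector_mult_diff_rdistrib A[THEN cinner_hermitian] algebra_simps)
  have B: "hermitian (A3 - A2)" "hermitian (A1 - A3)" "hermitian (A2 - A1)"
    using A by (auto intro: hermitian_diff)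
  show "form_n_minus (graph A1 \<times> graph A2 \<times> graph A3) Omega
      = mat_n_minus (A3 - A2) + mat_n_minus (A1 - A3) + mat_n_minus (A2 - A1)"
    using form_n_minus_image[OF lin subspace_horizontal inj herm_form_Omega herm_form_block_form[OF B] eq]
    by (simp add: im form_n_minus_block_form[OF B])
  show "form_n_plus (graph A1 \<times> graph A2 \<times> graph A3) Omega
      = mat_n_minus (A2 - A3) + mat_n_minus (A3 - A1) + mat_n_minus (A1 - A2)"
    using form_n_plus_image[OF lin subspace_horizontal inj herm_form_Omega herm_form_block_form[OF B] eq]
    by (simp add: im form_n_plus_block_form[OF B])
qed

lemma mat_n_minus_mat_1 [simp]: "mat_n_minus (mat 1 :: complex^'n^'n::finite) = 0"
proof -
  have "mat_eigenspace (mat 1 :: complex^'n^'n) l = {0}" if "l < 0" for l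
  proof -
    have "x = 0" if "x = complex_of_real l *s x" for x :: "complex^'n"
    proof -
      have "x $ i = complex_of_real l * x $ i" for i
        using arg_cong[OF that, of "\<lambda>x. x $ i"] by simp
      then show "x = 0" using \<open>l < 0\<close> by (simp add: vec_eq_iff)
    qed
    then show ?thesis by (auto simp: mat_eigenspace_def)
  qed
  then show ?thesis by (simp add: mat_n_minus_def cong: conj_cong)
qed

lemma hermitian_mat_1: "hermitian (mat 1)"
  by (auto simp: hermitian_def mat_def)

lemma mat_n_minus_minus_mat_1: "mat_n_minus (- mat 1 :: complex^'n^'n::finite) = CARD('n)"
  using mat_n_minus_total[OF hermitian_mat_1, where ?'n = 'n] by simp

text \<open>With \<open>y = x + w\<close> and \<open>z = z\<^sub>0 - A x\<close> the form splits into \<open>2 A\<close> and a hyperbolic form in \<open>(w, z\<^sub>0)\<close>,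
  which \<open>w = p + q\<close>, \<open>z\<^sub>0 = p - q\<close> diagonalises.\<close>

lemma form_n_minus_axis:
  fixes A :: "complex^'n^'n::finite"
  assumes A: "hermitian A"
  shows "form_n_minus (graph 0 \<times> graph A \<times> graph_inf) Omega = mat_n_minus A + CARD('n)"
proof -
  define \<phi> :: "'n triple \<Rightarrow> 'n triple" where
    "\<phi> = (\<lambda>u. let x = fst (fst u); p = fst (fst (snd u)); q = fst (snd (snd u))
       in ((x, 0), (x + p + q, A *v (x + p + q)), (0, p - q - A *v x)))"
  have lin: "Vector_Spaces.linear scale6 scale6 \<phi>"
    by unfold_locales
      (simp_all add: \<phi>_def Let_def scale6_def scale2_def vec.scale_right_distrib
        vec.scale_right_diff_distrib matrix_vector_right_distrib vector_scalar_commute)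
  have inj: "inj_on \<phi> horizontal"
  proof (rule inj_onI)
    fix u v assume uv: "u \<in> horizontal" "v \<in> horizontal" and eq: "\<phi> u = \<phi> v"
    obtain x p q where u: "u = ((x, 0), (p, 0), (q, 0))" using uv by (auto simp: mem_horizontal)
    obtain x' p' q' where v: "v = ((x', 0), (p', 0), (q', 0))" using uv by (auto simp: mem_horizontal)
    have e: "x = x'" "p + q = p' + q'" "p - q = p' - q'"
      using eq by (auto simp: u v \<phi>_def add.assoc)
    have "2 *\<^sub>R p = (p + q) + (p - q)" "2 *\<^sub>R p' = (p' + q') + (p' - q')"
      by (simp_all add: scaleR_2)
    then have "2 *\<^sub>R p = 2 *\<^sub>R p'" using e by metis
    then have "p = p'" by simp
    then show "u = v" using e by (simp add: u v)
  qed
  have im: "\<phi> ` horizontal = graph 0 \<times> graph A \<times> graph_inf"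
  proof
    show "\<phi> ` horizontal \<subseteq> graph 0 \<times> graph A \<times> graph_inf"
      by (auto simp: \<phi>_def graph_def graph_inf_def Let_def)
    show "graph 0 \<times> graph A \<times> graph_inf \<subseteq> \<phi> ` horizontal"
    proof
      fix w :: "'n triple" assume "w \<in> graph 0 \<times> graph A \<times> graph_inf"
      then obtain x y z where w: "w = ((x, 0), (y, A *v y), (0, z))"
        by (auto simp: graph_def graph_inf_def)
      define p q where "p = (1/2) *\<^sub>R ((y - x) + (z + A *v x))"
        and "q = (1/2) *\<^sub>R ((y - x) - (z + A *v x))"
      have "(1/2) *\<^sub>R (s + d) + (1/2) *\<^sub>R (s - d) = s" "(1/2) *\<^sub>R (s + d) - (1/2) *\<^sub>R (s - d) = d"
        for s d :: "complex^'n"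
        unfolding scaleR_right_distrib[symmetric] scaleR_right_diff_distrib[symmetric] by simp_all
      then have "p + q = y - x" "p - q = z + A *v x" by (simp_all only: p_def q_def)
      then have "w = \<phi> ((x, 0), (p, 0), (q, 0))" by (simp add: w \<phi>_def add.assoc)
      moreover have "((x, 0), (p, 0), (q, 0)) \<in> horizontal" by (auto simp: mem_horizontal)
      ultimately show "w \<in> \<phi> ` horizontal" by blast
    qed
  qed
  have m1: "(- mat 1 :: complex^'n^'n) *v x = - x" for x
    using matrix_vector_mult_diff_rdistrib[of 0 "mat 1" x] by simp
  have eq: "Omega (\<phi> u) (\<phi> v) = block_form A (mat 1) (- mat 1) u v" for u v
    by (simp add: Omega_alt omega_def \<phi>_def Let_def block_form_def mat_form_def cinner_simps m1
        matrix_vector_right_distrib A[THEN cinner_hermitian] algebra_simps)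
  note B = A hermitian_mat_1 hermitian_mat_1[THEN hermitian_uminus]
  \<comment> \<open>The hyperbolic part contributes through the blocks \<open>mat 1\<close> and
    \<open>- mat 1\<close>, that is, 0 and \<open>CARD('n)\<close> negative eigenvalues.\<close>
  show ?thesis
    using form_n_minus_image[OF lin subspace_horizontal inj herm_form_Omega herm_form_block_form[OF B] eq]
    by (simp add: im form_n_minus_block_form[OF B] mat_n_minus_minus_mat_1)
qed

section \<open>Symplectic maps and Lagrangian planes\<close>

text \<open>Suitable test vectors turn \<open>omega\<close> into the squared norms of the two
  components, up to sign.\<close>

lemma omega_nondegenerate:
  assumes "\<And>v. omega u v = 0"
  shows "u = 0"
proof -
  have "cinner (fst u) (fst u) = 0" "cinner (snd u) (snd u) = 0"
    using assms[of "(0, fst u)"] assms[of "(snd u, 0)"] by (simp_all add: omega_def)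
  then have "fst u = 0" "snd u = 0" by (metis Re_cinner inner_eq_zero_iff zero_complex.sel(1))+
  then show ?thesis by (simp add: prod_eq_iff)
qed

context
  fixes T :: "'n::finite sympl \<Rightarrow> 'n sympl"
  assumes T: "symplectic_map T"
begin

lemma symplectic_map_linear: "Vector_Spaces.linear scale2 scale2 T"
  and symplectic_map_omega: "omega (T u) (T v) = omega u v"
  using T unfolding symplectic_map_def by blast+

interpretation T: Vector_Spaces.linear scale2 scale2 T by (rule symplectic_map_linear)

lemma symplectic_map_inj: "inj T"
proof -
  have "u = 0" if "T u = 0" for u
    by (rule omega_nondegenerate, subst symplectic_map_omega[symmetric]) (simp add: that omega_def)
  then show ?thesis by (simp add: T.inj_iff_eq_0)
qed

lemma symplectic_map_surj: "surj T"
  by (rule sp2.linear_inj_imp_surj[OF symplectic_map_linear symplectic_map_inj])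

lemma lagrangian_image:
  assumes "lagrangian L"
  shows "lagrangian (T ` L)"
proof -
  have L: "sp2.subspace L" "L = {v. \<forall>u\<in>L. omega u v = 0}" using assms by (auto simp: lagrangian_def)
  \<comment> \<open>Surjectivity of \<open>T\<close> allows \<open>v\<close> to be written as
    \<open>T w\<close>, so the annihilator of the image is the image of the annihilator.\<close>
  have "v \<in> T ` L \<longleftrightarrow> (\<forall>u\<in>L. omega (T u) v = 0)" for v
  proof -
    obtain w where w: "v = T w" using symplectic_map_surj by (metis surjD)
    have "T w \<in> T ` L \<longleftrightarrow> w \<in> L" using symplectic_map_inj by (simp add: inj_image_mem_iff)
    then show ?thesis using L(2) by (auto simp: w symplectic_map_omega)
  qed
  then show ?thesis using T.subspace_image[OF L(1)] by (auto simp: lagrangian_def)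
qed

text \<open>Applying \<open>T\<close> in each slot leaves \<open>Omega\<close> unchanged and is
  injective, so the transport lemmas apply although \<open>T\<close> need not be unitary.\<close>

lemma
  assumes S: "sp2.subspace L1" "sp2.subspace L2" "sp2.subspace L3"
  shows form_n_minus_symplectic:
      "form_n_minus (T ` L1 \<times> T ` L2 \<times> T ` L3) Omega = form_n_minus (L1 \<times> L2 \<times> L3) Omega"
    and form_n_plus_symplectic:
      "form_n_plus (T ` L1 \<times> T ` L2 \<times> T ` L3) Omega = form_n_plus (L1 \<times> L2 \<times> L3) Omega"
proof -
  define \<phi> where "\<phi> = (\<lambda>u. (T (fst u), T (fst (snd u)), T (snd (snd u))))"
  have lin: "Vector_Spaces.linear scale6 scale6 \<phi>"
    by unfold_locales (auto simp: \<phi>_def scale6_def T.add T.scale)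
  have inj: "inj_on \<phi> (L1 \<times> L2 \<times> L3)"
    using symplectic_map_inj by (auto simp: \<phi>_def inj_on_def)
  have V: "sp6.subspace (L1 \<times> L2 \<times> L3)"
    using S unfolding sp6.subspace_def sp2.subspace_def by (auto simp: scale6_def zero_prod_def)
  have im: "\<phi> ` (L1 \<times> L2 \<times> L3) = T ` L1 \<times> T ` L2 \<times> T ` L3"
    by (force simp: \<phi>_def image_iff)
  have eq: "Omega (\<phi> u) (\<phi> v) = Omega u v" for u v
    by (simp add: Omega_alt \<phi>_def symplectic_map_omega)
  show "form_n_minus (T ` L1 \<times> T ` L2 \<times> T ` L3) Omega = form_n_minus (L1 \<times> L2 \<times> L3) Omega"
    using form_n_minus_image[OF lin V inj herm_form_Omega herm_form_Omega eq] by (simp add: im)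
  show "form_n_plus (T ` L1 \<times> T ` L2 \<times> T ` L3) Omega = form_n_plus (L1 \<times> L2 \<times> L3) Omega"
    using form_n_plus_image[OF lin V inj herm_form_Omega herm_form_Omega eq] by (simp add: im)
qed

lemma dim_Int_symplectic: "sp2.dim (T ` L1 \<inter> T ` L2) = sp2.dim (L1 \<inter> L2)"
proof -
  interpret p: finite_dimensional_vector_space_pair scale2 basis2 scale2 basis2 ..
  show ?thesis
    using p.dim_image_eq[OF symplectic_map_linear] symplectic_map_inj
    by (metis image_Int inj_on_subset subset_UNIV)
qed

end

section \<open>Lagrangian planes as graphs of Hermitian matrices\<close>

lemma hermitian_iff_cinner: "hermitian A \<longleftrightarrow> (\<forall>x y. cinner x (A *v y) = cinner (A *v x) y)"
proof
  assume *: "\<forall>x y. cinner x (A *v y) = cinner (A *v x) y"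
  have ax: "cinner (axis i 1) y = cnj (y $ i)" "cinner y (axis i 1) = y $ i" for i y
    by (simp_all add: cinner_def axis_def if_distrib[of "\<lambda>z. z * _"] if_distrib[of "\<lambda>z. _ * z"]
        if_distrib[of cnj] cong: if_cong)
  have "(A *v axis j 1) $ i = A $ i $ j" for i j
    by (simp add: matrix_vector_mult_def axis_def if_distrib[of "\<lambda>z. _ * z"] cong: if_cong)
  then have "A $ i $ j = cnj (A $ j $ i)" for i j
    using *[rule_format, of "axis j 1" "axis i 1"] by (simp add: ax)
  then show "hermitian A" unfolding hermitian_def by blast
qed (simp add: cinner_hermitian)

lemma lagrangian_graph:
  assumes "hermitian A"
  shows "lagrangian (graph A)"
proof -
  have "v \<in> graph A" if "\<And>x. cinner x (snd v) = cinner (A *v x) (fst v)" for v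
  proof -
    have "cinner x (snd v - A *v fst v) = 0" for x
      using that[of x] cinner_hermitian[OF assms, of x "fst v"] by (simp add: cinner_simps)
    then have "snd v - A *v fst v = 0"
      by (metis Re_cinner inner_eq_zero_iff zero_complex.sel(1))
    then show ?thesis by (auto simp: graph_def prod_eq_iff intro: exI[of _ "fst v"])
  qed
  moreover have "sp2.subspace (graph A)"
    unfolding sp2.subspace_def
    by (auto simp: graph_def scale2_def zero_prod_def matrix_vector_right_distrib vector_scalar_commute
        intro: exI[of _ 0])
  ultimately show ?thesis
    unfolding lagrangian_def
    by (auto simp: graph_def omega_def cinner_hermitian[OF assms])
qed

lemma lagrangian_graph_inf: "lagrangian (graph_inf :: 'n::finite sympl set)"
proof -
  have "x = 0" if "\<forall>y. cinner y x = 0" for x :: "complex^'n"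
    using that by (metis Re_cinner inner_eq_zero_iff zero_complex.sel(1))
  then have "graph_inf = {v :: 'n sympl. \<forall>u\<in>graph_inf. omega u v = 0}"
    by (auto simp: graph_inf_def omega_def)
  moreover have "sp2.subspace (graph_inf :: 'n sympl set)"
    unfolding sp2.subspace_def by (auto simp: graph_inf_def scale2_def zero_prod_def)
  ultimately show ?thesis by (simp add: lagrangian_def)
qed

text \<open>Transversality makes \<open>L\<close> single-valued over the first component, maximality
  makes it defined everywhere, and isotropy makes the resulting matrix Hermitian.\<close>

lemma lagrangian_eq_graph:
  fixes L :: "'n::finite sympl set"
  assumes L: "lagrangian L" and tr: "\<And>y. (0, y) \<in> L \<Longrightarrow> y = 0"
  obtains A where "hermitian A" "L = graph A"
proof -
  have sub: "sp2.subspace L" and mem: "\<And>v. v \<in> L \<longleftrightarrow> (\<forall>u\<in>L. omega u v = 0)"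
    using L by (auto simp: lagrangian_def)
  have add: "(x + x', y + y') \<in> L" if "(x, y) \<in> L" "(x', y') \<in> L" for x x' y y'
    using sp2.subspace_add[OF sub that] by simp
  have scl: "(c *s x, c *s y) \<in> L" if "(x, y) \<in> L" for c x y
    using sp2.subspace_scale[OF sub that, of c] by (simp add: scale2_def)
  have ex: "\<exists>y. (x, y) \<in> L" for x
  proof (rule ccontr)
    assume no: "\<nexists>y. (x, y) \<in> L"
    have "real_vector.subspace (fst ` L)"
      unfolding real_vector.subspace_def
    proof (intro conjI ballI allI)
      show "0 \<in> fst ` L" using sp2.subspace_0[OF sub] by force
      show "x + y \<in> fst ` L" if "x \<in> fst ` L" "y \<in> fst ` L" for x y
        using that add by force
      show "c *\<^sub>R x \<in> fst ` L" if "x \<in> fst ` L" for c x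
        using that scl[of _ _ "of_real c"] by (force simp flip: cv.scale_of_real)
    qed
    moreover have "fst ` L \<noteq> UNIV" using no by force
    ultimately obtain z where z: "z \<noteq> 0" "\<And>x. x \<in> fst ` L \<Longrightarrow> z \<bullet> x = 0"
      using span_not_UNIV_orthogonal[of "fst ` L"] by (auto simp: real_vector.span_eq_iff[THEN iffD2])
    \<comment> \<open>The vector \<open>z\<close> is orthogonal to the projection of
      \<open>L\<close> over the reals only. As that projection is stable under multiplication by the
      imaginary unit, the orthogonality is also complex.\<close>
    have "cinner x z = 0" if "(x, y) \<in> L" for x y
    proof -
      have "Re (cinner x z) = 0" using z(2)[of x] that by (force simp: Re_cinner inner_commute)
      moreover have "Re (cinner (\<i> *s x) z) = 0"
        using z(2)[of "\<i> *s x"] scl[OF that, of \<i>] by (force simp: Re_cinner inner_commute)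
      ultimately show ?thesis by (simp add: cinner_scale_left complex_eq_iff)
    qed
    \<comment> \<open>Now \<open>(0, z)\<close> is annihilated by all of \<open>L\<close>, so it
      belongs to \<open>L\<close>, against transversality.\<close>
    then have "(0, z) \<in> L" by (subst mem) (auto simp: omega_def)
    then show False using tr z(1) by blast
  qed
  have uniq: "y = y'" if "(x, y) \<in> L" "(x, y') \<in> L" for x y y'
    using tr[of "y - y'"] add[OF that(1) scl[OF that(2), of "-1"]] by simp
  define g where "g = (\<lambda>x. SOME y. (x, y) \<in> L)"
  have g: "(x, g x) \<in> L" for x unfolding g_def by (rule someI_ex[OF ex])
  have "Vector_Spaces.linear (*s) (*s) g"
    by unfold_locales (use uniq[OF g add[OF g g]] uniq[OF g scl[OF g]] in auto)
  then have A: "matrix g *v x = g x" for x by (rule matrix_works)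
  have "L = graph (matrix g)" using g uniq by (auto simp: graph_def A)
  moreover have "hermitian (matrix g)"
    unfolding hermitian_iff_cinner
  proof (intro allI)
    fix x y show "cinner x (matrix g *v y) = cinner (matrix g *v x) y"
      using mem[of "(y, g y)"] g by (force simp: A omega_def)
  qed
  ultimately show thesis using that by blast
qed

text \<open>Two vectors \<open>(x, t x)\<close> and \<open>(y, s y)\<close> of \<open>L\<close> with \<open>t \<noteq> s\<close> satisfy \<open>(s - t) \<langle>x, y\<rangle> = 0\<close>, so distinct
  parameters give orthogonal vectors.\<close>

lemma finite_nontransversal_parameters:
  fixes L :: "'n::finite sympl set"
  assumes "lagrangian L"
  shows "finite {t::real. \<exists>x. x \<noteq> 0 \<and> (x, complex_of_real t *s x) \<in> L}" (is "finite ?S")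
proof -
  have "\<forall>t\<in>?S. \<exists>x. x \<noteq> 0 \<and> (x, complex_of_real t *s x) \<in> L" by blast
  then obtain f where "\<forall>t\<in>?S. f t \<noteq> 0 \<and> (f t, complex_of_real t *s f t) \<in> L"
    by (rule bchoice[THEN exE])
  then have f: "f t \<noteq> 0 \<and> (f t, complex_of_real t *s f t) \<in> L" if "t \<in> ?S" for t
    using that by blast
  have orth: "cinner (f t) (f s) = 0" if "t \<in> ?S" "s \<in> ?S" "t \<noteq> s" for t s
  proof -
    have "omega (f t, complex_of_real t *s f t) (f s, complex_of_real s *s f s) = 0"
      using f[OF that(1)] f[OF that(2)] assms unfolding lagrangian_def by blast
    then have "complex_of_real (s - t) * cinner (f t) (f s) = 0"
      by (simp add: omega_def cinner_simps algebra_simps)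
    then show ?thesis using that(3) by simp
  qed
  \<comment> \<open>Nonzero pairwise orthogonal vectors are linearly independent over the reals, so
    there are only finitely many of them.\<close>
  have "pairwise orthogonal (f ` ?S)"
    unfolding pairwise_def orthogonal_def
    using orth by (auto simp: image_iff simp flip: Re_cinner) (metis zero_complex.sel(1))
  moreover have "0 \<notin> f ` ?S" using f by force
  ultimately have "finite (f ` ?S)"
    using pairwise_orthogonal_independent independent_imp_finite by blast
  moreover have "inj_on f ?S"
  proof (rule inj_onI, rule ccontr)
    fix t s assume "t \<in> ?S" "s \<in> ?S" "f t = f s" "t \<noteq> s"
    then have "cinner (f t) (f t) = 0" using orth[of t s] by simp
    then have "f t = 0" by (metis Re_cinner inner_eq_zero_iff zero_complex.sel(1))
    then show False using f \<open>t \<in> ?S\<close> by blast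
  qed
  ultimately show ?thesis by (rule finite_imageD)
qed

text \<open>Each plane excludes finitely many parameters, so some real \<open>t\<close> is
  admissible for the whole family. Any finite number of planes can thus be treated in one coordinate
  system.\<close>

lemma common_graph_coordinates:
  fixes F :: "'n::finite sympl set set"
  assumes "finite F" "F \<subseteq> Lambda"
  obtains T where "symplectic_map T" "\<And>L. L \<in> F \<Longrightarrow> \<exists>A. hermitian A \<and> T ` L = graph A"
proof -
  have "finite (\<Union>L\<in>F. {t::real. \<exists>x. x \<noteq> 0 \<and> (x, complex_of_real t *s x) \<in> L})"
    using assms finite_nontransversal_parameters by (auto simp: Lambda_def)
  then obtain t :: real where t: "\<And>L x. L \<in> F \<Longrightarrow> (x, complex_of_real t *s x) \<in> L \<Longrightarrow> x = 0"
    using ex_new_if_finite[OF infinite_UNIV_char_0] by fastforce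
  \<comment> \<open>This map sends the plane of all \<open>(x, t x)\<close> onto
    \<open>graph_inf\<close>, so transversality to the former becomes the hypothesis of
    \<open>lagrangian_eq_graph\<close>.\<close>
  define T :: "'n sympl \<Rightarrow> 'n sympl" where "T = (\<lambda>u. (snd u - complex_of_real t *s fst u, - fst u))"
  have T: "symplectic_map T"
    unfolding symplectic_map_def
  proof
    show "Vector_Spaces.linear scale2 scale2 T"
      by unfold_locales
        (auto simp: T_def scale2_def vec.scale_right_distrib vec.scale_right_diff_distrib mult.commute)
    show "\<forall>u v. omega (T u) (T v) = omega u v"
      by (simp add: T_def omega_def cinner_simps algebra_simps)
  qed
  have "\<exists>A. hermitian A \<and> T ` L = graph A" if "L \<in> F" for L
  proof -
    have "lagrangian (T ` L)" using that assms by (auto simp: Lambda_def intro!: lagrangian_image[OF T])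
    moreover have "y = 0" if "(0, y) \<in> T ` L" for y
    proof -
      have "(- y, complex_of_real t *s (- y)) \<in> L"
        using that by (auto simp: T_def)
      then have "- y = 0" by (rule t[OF \<open>L \<in> F\<close>])
      then show ?thesis by simp
    qed
    ultimately show ?thesis using lagrangian_eq_graph by metis
  qed
  then show thesis using that T by blast
qed

text \<open>The intersection is an injective linear image of the kernel of \<open>A - B\<close>, so
  this is the total count for \<open>A - B\<close>.\<close>

lemma dim_graph_Int_graph:
  fixes A B :: "complex^'n^'n::finite"
  assumes "hermitian A" "hermitian B"
  shows "mat_n_minus (A - B) + mat_n_minus (B - A) + sp2.dim (graph A \<inter> graph B) = CARD('n)"
proof -
  interpret p: finite_dimensional_vector_space_pair "(*s)" "cart_basis :: (complex^'n) set" scale2 basis2 ..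
  have lin: "Vector_Spaces.linear (*s) scale2 (\<lambda>x. (x, A *v x))"
    by unfold_locales (auto simp: scale2_def matrix_vector_right_distrib vector_scalar_commute)
  have "graph A \<inter> graph B = (\<lambda>x. (x, A *v x)) ` {x. (A - B) *v x = 0}"
    by (auto simp: graph_def matrix_vector_mult_diff_rdistrib)
  moreover have "sp2.dim ((\<lambda>x. (x, A *v x)) ` {x. (A - B) *v x = 0}) = vec.dim {x. (A - B) *v x = 0}"
    by (rule p.dim_image_eq[OF lin]) (auto simp: inj_on_def)
  ultimately show ?thesis
    using mat_n_minus_total[OF hermitian_diff[OF assms]] by simp
qed

section \<open>The Duistermaat index\<close>

text \<open>The explicit formula for the Duistermaat index, which serves as the witness for
  existence.\<close>

definition omega_index :: "'n::finite sympl set \<Rightarrow> 'n sympl set \<Rightarrow> 'n sympl set \<Rightarrow> int"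
  where "omega_index L1 L2 L3 =
    int (form_n_minus (L1 \<times> L2 \<times> L3) Omega) - int CARD('n) + int (sp2.dim (L1 \<inter> L3))"

definition graph_index :: "complex^'n^'n::finite \<Rightarrow> complex^'n^'n \<Rightarrow> complex^'n^'n \<Rightarrow> int"
  where "graph_index A B C =
    int (mat_n_minus (B - A)) + int (mat_n_minus (C - B)) - int (mat_n_minus (C - A))"

text \<open>By \<open>dim_graph_Int_graph\<close>, adding \<open>mat_n_minus (A - C)\<close> to the
  correction by \<open>CARD('n)\<close> and the intersection dimension leaves minus
  \<open>mat_n_minus (C - A)\<close>.\<close>

lemma omega_index_graph:
  assumes "hermitian A" "hermitian B" "hermitian C"
  shows "omega_index (graph A) (graph B) (graph C) = graph_index A B C"
  using form_n_minus_graphs[OF assms] dim_graph_Int_graph[OF assms(1,3)]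
  by (simp add: omega_index_def graph_index_def)

lemma omega_index_symplectic:
  assumes "symplectic_map T" "L1 \<in> Lambda" "L2 \<in> Lambda" "L3 \<in> Lambda"
  shows "omega_index (T ` L1) (T ` L2) (T ` L3) = omega_index L1 L2 L3"
  using assms form_n_minus_symplectic[OF assms(1)] dim_Int_symplectic[OF assms(1)]
  by (simp add: omega_index_def Lambda_def lagrangian_def)

text \<open>Subadditivity for \<open>C - A = (B - A) + (C - B)\<close> gives the lower bound. For
  \<open>B - A = (C - A) + (B - C)\<close> it bounds the index by the counts of \<open>B - C\<close>
  and \<open>C - B\<close>, which total at most \<open>CARD('n)\<close>.\<close>

lemma graph_index_range:
  fixes A B C :: "complex^'n^'n::finite"
  assumes "hermitian A" "hermitian B" "hermitian C"
  shows "graph_index A B C \<in> {0..int CARD('n)}"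
proof -
  have "mat_n_minus (C - A) \<le> mat_n_minus (B - A) + mat_n_minus (C - B)"
    using mat_n_minus_add_le[of "B - A" "C - B"] assms by (simp add: hermitian_diff)
  moreover have "mat_n_minus (B - A) \<le> mat_n_minus (C - A) + mat_n_minus (B - C)"
    using mat_n_minus_add_le[of "C - A" "B - C"] assms by (simp add: hermitian_diff)
  moreover have "mat_n_minus (B - C) + mat_n_minus (C - B) \<le> CARD('n)"
    using dim_graph_Int_graph[OF assms(2,3)] by simp
  ultimately show ?thesis by (simp add: graph_index_def)
qed

lemma duistermaat_index_graph:
  assumes j: "is_duistermaat_index j" and H: "hermitian A" "hermitian B" "hermitian C"
  shows "j (graph A, graph B, graph C) = graph_index A B C"
proof -
  have lag: "graph A \<in> Lambda" "graph B \<in> Lambda" "graph C \<in> Lambda" "graph_inf \<in> Lambda"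
    using H by (auto simp: Lambda_def lagrangian_graph lagrangian_graph_inf)
  have "j (graph X, graph Y, graph_inf) = int (mat_n_minus (Y - X))"
    if X: "hermitian X" and Y: "hermitian Y" for X Y
  proof -
    \<comment> \<open>A symplectic shear that fixes \<open>graph_inf\<close> and takes
      \<open>graph X\<close> to \<open>graph 0\<close>, which leads to the normalisation
      axiom.\<close>
    define S :: "'a sympl \<Rightarrow> 'a sympl" where "S = (\<lambda>u. (fst u, snd u - X *v fst u))"
    have S: "symplectic_map S"
      unfolding symplectic_map_def
    proof
      show "Vector_Spaces.linear scale2 scale2 S"
        by unfold_locales
          (auto simp: S_def scale2_def vec.scale_right_diff_distrib matrix_vector_right_distrib
            vector_scalar_commute)
      show "\<forall>u v. omega (S u) (S v) = omega u v"
        by (simp add: S_def omega_def cinner_simps cinner_hermitian[OF X])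
    qed
    have im: "S ` graph Z = graph (Z - X)" for Z
      by (auto simp: S_def graph_def image_iff matrix_vector_mult_diff_rdistrib)
    have "S ` graph_inf = graph_inf" by (force simp: S_def graph_inf_def image_iff)
    moreover have "graph X \<in> Lambda" "graph Y \<in> Lambda"
      using X Y by (auto simp: Lambda_def lagrangian_graph)
    ultimately have "j (graph X, graph Y, graph_inf) = j (graph 0, graph (Y - X), graph_inf)"
      using j S lag(4) im[of X] im[of Y] unfolding is_duistermaat_index_def by (metis diff_self)
    then show ?thesis
      using j hermitian_diff[OF Y X] unfolding is_duistermaat_index_def by metis
  qed
  \<comment> \<open>The cocycle identity with fourth plane \<open>graph_inf\<close> expresses the
    value by three values of the kind just computed.\<close>
  then show ?thesis
    using j lag H unfolding is_duistermaat_index_def graph_index_def by (smt (verit))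
qed

lemma is_duistermaat_index_omega_index:
  "is_duistermaat_index
    (restrict (\<lambda>(L1, L2, L3). omega_index L1 L2 L3) (Lambda \<times> Lambda \<times> (Lambda :: 'n::finite sympl set set)))"
    (is "is_duistermaat_index ?j")
proof -
  have eq: "omega_index L1 L2 L3 = graph_index A1 A2 A3"
    if "symplectic_map T" "L1 \<in> Lambda" "L2 \<in> Lambda" "L3 \<in> Lambda"
      "T ` L1 = graph A1" "T ` L2 = graph A2" "T ` L3 = graph A3"
      "hermitian A1" "hermitian A2" "hermitian A3"
    for T and L1 L2 L3 :: "'n sympl set" and A1 A2 A3
    using omega_index_symplectic[OF that(1-4)] omega_index_graph[OF that(8-10)] that(5-7) by simp
  have "omega_index L1 L2 L3 \<in> {0..int CARD('n)}"
    if "L1 \<in> Lambda" "L2 \<in> Lambda" "L3 \<in> Lambda" for L1 L2 L3 :: "'n sympl set"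
  proof -
    obtain T where T: "symplectic_map T"
      "\<And>L. L \<in> {L1, L2, L3} \<Longrightarrow> \<exists>A. hermitian A \<and> T ` L = graph A"
      using common_graph_coordinates[of "{L1, L2, L3}"] \<open>L1 \<in> Lambda\<close> \<open>L2 \<in> Lambda\<close> \<open>L3 \<in> Lambda\<close>
      by blast
    then obtain A1 A2 A3 where "T ` L1 = graph A1" "T ` L2 = graph A2" "T ` L3 = graph A3"
      "hermitian A1" "hermitian A2" "hermitian A3" by (metis insertI1 insertI2)
    then show ?thesis using eq[OF T(1) that] graph_index_range by metis
  qed
  then have 1: "?j \<in> (Lambda \<times> Lambda \<times> Lambda) \<rightarrow>\<^sub>E {0..int CARD('n)}" by auto
  have h0: "hermitian (0 :: complex^'n^'n)" by (simp add: hermitian_def)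
  have 2: "?j (graph 0, graph A, graph_inf) = int (mat_n_minus A)" if A: "hermitian A" for A
  proof -
    \<comment> \<open>The dimension term vanishes, and the \<open>CARD('n)\<close> from
      \<open>form_n_minus_axis\<close> cancels the one subtracted in
      \<open>omega_index\<close>.\<close>
    have "graph 0 \<inter> graph_inf \<subseteq> {0 :: 'n sympl}" by (auto simp: graph_def graph_inf_def zero_prod_def)
    then have "sp2.dim (graph 0 \<inter> graph_inf :: 'n sympl set) = 0" by simp
    then show ?thesis
      using A h0 lagrangian_graph[OF A] lagrangian_graph[OF h0]
      by (simp add: Lambda_def lagrangian_graph_inf omega_index_def form_n_minus_axis)
  qed
  have 3: "?j (T ` L1, T ` L2, T ` L3) = ?j (L1, L2, L3)"
    if "symplectic_map T" "L1 \<in> Lambda" "L2 \<in> Lambda" "L3 \<in> Lambda" for T L1 L2 L3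
    using that omega_index_symplectic[OF that] lagrangian_image[OF that(1)] by (simp add: Lambda_def)
  have 4: "?j (L1, L2, L3) - ?j (L1, L2, L4) + ?j (L1, L3, L4) - ?j (L2, L3, L4) = 0"
    if L: "L1 \<in> Lambda" "L2 \<in> Lambda" "L3 \<in> Lambda" "L4 \<in> Lambda" for L1 L2 L3 L4
  proof -
    obtain T where T: "symplectic_map T"
      "\<And>L. L \<in> {L1, L2, L3, L4} \<Longrightarrow> \<exists>A. hermitian A \<and> T ` L = graph A"
      using common_graph_coordinates[of "{L1, L2, L3, L4}"] L by blast
    then obtain A1 A2 A3 A4 where "T ` L1 = graph A1" "T ` L2 = graph A2" "T ` L3 = graph A3"
      "T ` L4 = graph A4" "hermitian A1" "hermitian A2" "hermitian A3" "hermitian A4"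
      by (metis insertI1 insertI2)
    \<comment> \<open>In common coordinates \<open>graph_index\<close> is a coboundary of the
      pairwise counts, so all terms cancel.\<close>
    then show ?thesis
      using eq[OF T(1)] L by (simp add: graph_index_def)
  qed
  show ?thesis
    unfolding is_duistermaat_index_def using 1 2 3 4 by blast
qed

text \<open>The right-hand side does not mention \<open>j\<close>. This gives uniqueness and, later,
  the evaluation of the index defined by \<open>THE\<close>.\<close>

lemma is_duistermaat_index_eq_graph_index:
  assumes T: "symplectic_map T" and L: "L1 \<in> Lambda" "L2 \<in> Lambda" "L3 \<in> Lambda"
    and im: "T ` L1 = graph A" "T ` L2 = graph B" "T ` L3 = graph C"
    and H: "hermitian A" "hermitian B" "hermitian C"
  shows "is_duistermaat_index j \<Longrightarrow> j (L1, L2, L3) = graph_index A B C"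
  using duistermaat_index_graph[OF _ H] T L unfolding im[symmetric] is_duistermaat_index_def
  by metis

lemma is_duistermaat_index_unique:
  assumes j: "is_duistermaat_index j" and k: "is_duistermaat_index k"
  shows "j = k"
proof (rule PiE_ext)
  show "j \<in> (Lambda \<times> Lambda \<times> Lambda) \<rightarrow>\<^sub>E {0..int CARD('a)}" "k \<in> (Lambda \<times> Lambda \<times> Lambda) \<rightarrow>\<^sub>E {0..int CARD('a)}"
    using j k by (auto simp: is_duistermaat_index_def)
  fix x :: "'a sympl set \<times> 'a sympl set \<times> 'a sympl set" assume "x \<in> Lambda \<times> Lambda \<times> Lambda"
  then obtain L1 L2 L3 where x: "x = (L1, L2, L3)" and L: "L1 \<in> Lambda" "L2 \<in> Lambda" "L3 \<in> Lambda"
    by auto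
  obtain T where T: "symplectic_map T"
    "\<And>L. L \<in> {L1, L2, L3} \<Longrightarrow> \<exists>A. hermitian A \<and> T ` L = graph A"
    using common_graph_coordinates[of "{L1, L2, L3}"] L by blast
  then obtain A1 A2 A3 where "T ` L1 = graph A1" "T ` L2 = graph A2" "T ` L3 = graph A3"
    "hermitian A1" "hermitian A2" "hermitian A3" by (metis insertI1 insertI2)
  then show "j x = k x"
    unfolding x using is_duistermaat_index_eq_graph_index[OF T(1) L] j k by metis
qed

lemma is_duistermaat_index_The:
  "is_duistermaat_index (THE j :: 'n::finite sympl set \<times> 'n sympl set \<times> 'n sympl set \<Rightarrow> int. is_duistermaat_index j)"
  using theI[of is_duistermaat_index, OF is_duistermaat_index_omega_index]
    is_duistermaat_index_unique is_duistermaat_index_omega_index by blast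

theorem lemma4p1:
  fixes L1 L2 L3 :: "((complex^'n::finite) \<times> (complex^'n)) set"
  assumes "L1 \<in> Lambda" and "L2 \<in> Lambda" and "L3 \<in> Lambda"
  shows "hkw_index L1 L2 L3 = duistermaat_index L2 L1 L3 - duistermaat_index L3 L1 L2 \<and>
    real_of_int (duistermaat_index L1 L2 L3) =
      1 / 2 * (real CARD('n) - real (sp2.dim (L1 \<inter> L2)) + real (sp2.dim (L1 \<inter> L3))
        - real (sp2.dim (L2 \<inter> L3)) - real_of_int (hkw_index L1 L2 L3))"
proof -
  obtain T where T: "symplectic_map T"
    "\<And>L. L \<in> {L1, L2, L3} \<Longrightarrow> \<exists>A. hermitian A \<and> T ` L = graph A"
    using common_graph_coordinates[of "{L1, L2, L3}"] assms by blast
  then obtain A1 A2 A3 where im: "T ` L1 = graph A1" "T ` L2 = graph A2" "T ` L3 = graph A3"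
    and H: "hermitian A1" "hermitian A2" "hermitian A3" by (metis insertI1 insertI2)
  \<comment> \<open>One map \<open>T\<close> serves every order of the three planes, so all indices
    are expressed by the same three matrices.\<close>
  have ind: "duistermaat_index L1 L2 L3 = graph_index A1 A2 A3"
    "duistermaat_index L2 L1 L3 = graph_index A2 A1 A3"
    "duistermaat_index L3 L1 L2 = graph_index A3 A1 A2"
    unfolding duistermaat_index_def
    by (rule is_duistermaat_index_eq_graph_index[OF T(1)]; use assms im H is_duistermaat_index_The in blast)+
  have S: "sp2.subspace L1" "sp2.subspace L2" "sp2.subspace L3"
    using assms by (auto simp: Lambda_def lagrangian_def)
  have hkw: "hkw_index L1 L2 L3 =
      int (mat_n_minus (A2 - A3) + mat_n_minus (A3 - A1) + mat_n_minus (A1 - A2))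
      - int (mat_n_minus (A3 - A2) + mat_n_minus (A1 - A3) + mat_n_minus (A2 - A1))"
    unfolding hkw_index_def form_n_minus_symplectic[OF T(1) S, symmetric]
      form_n_plus_symplectic[OF T(1) S, symmetric] im form_n_minus_graphs[OF H] form_n_plus_graphs[OF H] ..
  have dims: "sp2.dim (L1 \<inter> L2) = sp2.dim (graph A1 \<inter> graph A2)"
    "sp2.dim (L1 \<inter> L3) = sp2.dim (graph A1 \<inter> graph A3)"
    "sp2.dim (L2 \<inter> L3) = sp2.dim (graph A2 \<inter> graph A3)"
    using dim_Int_symplectic[OF T(1)] im by metis+
  have tot: "real (mat_n_minus (A1 - A2)) + real (mat_n_minus (A2 - A1)) + real (sp2.dim (graph A1 \<inter> graph A2)) = CARD('n)"
    "real (mat_n_minus (A1 - A3)) + real (mat_n_minus (A3 - A1)) + real (sp2.dim (graph A1 \<inter> graph A3)) = CARD('n)"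
    "real (mat_n_minus (A2 - A3)) + real (mat_n_minus (A3 - A2)) + real (sp2.dim (graph A2 \<inter> graph A3)) = CARD('n)"
    using H dim_graph_Int_graph by (metis of_nat_add)+
  show ?thesis
    \<comment> \<open>The first equation is an identity between the pairwise counts. The second
      replaces each intersection dimension by means of \<open>tot\<close>.\<close>
    unfolding ind hkw dims graph_index_def using tot by (simp add: field_simps)
qed

end
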